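(* Let $u^\varepsilon$ be the Perron (minimal) solution of the problem $(E_\varepsilon)$: $\Delta_\infty u^\varepsilon=\zeta_\varepsilon(x,u^\varepsilon)$ in $\Omega$, $u^\varepsilon=\varphi^\varepsilon$ on $\partial\Omega$. Let $\Omega'\Subset\Omega$. There exist a universal constant $c>0$ and a small $\rho_0>0$ independent of $\varepsilon$ such that for every $x_0\in\{u^\varepsilon>\varepsilon\}\cap\Omega'$ and every $\rho$ with $\varepsilon\le\rho\le\rho_0$, $$c\,\rho<\sup_{B_\rho(x_0)}u^\varepsilon\le c^{-1}\bigl(\rho+u^\varepsilon(x_0)\bigr).$$
   Context: $\Delta_\infty u=(Du)^TD^2u\,Du=\sum_{i,j=1}^n u_{x_i}u_{x_j}u_{x_ix_j}$; $\mathbb{R}_+=[0,\infty)$. A function $u\in C(\Omega)$ is a viscosity sub-solution (super-solution) of $\Delta_\infty u=f(x,u)$ in $\Omega$ if whenever $\phi\in C^2(\Omega)$ and $u-\phi$ has a local maximum (minimum) at $x_0\in\Omega$ with $\phi(x_0)=u(x_0)$, then $\Delta_\infty\phi(x_0)\ge f(x_0,\phi(x_0))$ (resp. $\le$); a viscosity solution is both. Setting: $\Omega\subset\mathbb{R}^n$ is a bounded domain with smooth boundary; $\varepsilon>0$; $0\le\varphi^\varepsilon\in C(\overline\Omega)$ with $\|\varphi^\varepsilon\|_{L^\infty(\Omega)}\le\mathcal A$, $\mathcal A>0$ a constant; $\zeta_\varepsilon:\Omega\times\mathbb{R}_+\to\mathbb{R}_+$ is smooth and satisfies $0\le\zeta_\varepsilon(x,t)\le\frac{\mathcal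 B}{\varepsilon}\chi_{(0,\varepsilon)}(t)+\mathcal C$ for all $(x,t)$, with constants $\mathcal B,\mathcal C\ge0$ independent of $\varepsilon$, and $\mathfrak R:=\inf_{\Omega\times[a,b]}\varepsilon\zeta_\varepsilon(x,\varepsilon t)>0$ for some $0\le a<b$, with $\mathfrak R$ not depending on $\varepsilon$. Perron solution: let $\underline u^\varepsilon$ and $\overline u^\varepsilon$ be the viscosity solutions of $\Delta_\infty\underline u^\varepsilon=\sup_{\Omega\times[0,\infty)}\zeta_\varepsilon$ and $\Delta_\infty\overline u^\varepsilon=0$ in $\Omega$, both equal to $\varphi^\varepsilon$ on $\partial\Omega$. Then $u^\varepsilon(x)=\inf w(x)$ over all viscosity super-solutions $w\in C(\overline\Omega)$ of $\Delta_\infty w=\zeta_\varepsilon(x,w)$ in $\Omega$ with $\underline u^\varepsilon\le w\le\overline u^\varepsilon$ and $w=\varphi^\varepsilon$ on $\partial\Omega$; it is a viscosity solution of $(E_\varepsilon)$. $\Omega'\Subset\Omega$ means $\overline{\Omega'}$ is compact and contained in $\Omega$. A universal constant depends only on the dimension and the structural constants of the problem ($n,\mathcal A,\mathcal B,\mathcal C$ and $a,b,\mathfrak R$); in particular not on $\varepsilon$. *)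

theory Defs
  imports "HOL-Analysis.Analysis"
begin

(* Derivatives are taken within S, so for S = Omega x [0,inf) the classes below are the C^k
   functions up to the boundary t = 0 (one-sided derivatives there). For open S this is the usual
   notion. *)
primrec Ck_on :: "nat \<Rightarrow> 'a::real_normed_vector set \<Rightarrow> ('a \<Rightarrow> 'b::real_normed_vector) \<Rightarrow> bool" where
  "Ck_on 0 S = (\<lambda>f. continuous_on S f)"
| "Ck_on (Suc k) S = (\<lambda>f. \<exists>f'. (\<forall>x\<in>S. (f has_derivative f' x) (at x within S)) \<and>
                             (\<forall>v. Ck_on k S (\<lambda>x. f' x v)))"

definition smooth_on :: "'a::real_normed_vector set \<Rightarrow> ('a \<Rightarrow> 'b::real_normed_vector) \<Rightarrow> bool" where
  "smooth_on S f \<longleftrightarrow> (\<forall>k. Ck_on k S f)"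

(* The boundary is smooth in the sense that near each of its points Omega is the negativity set
   of a smooth function with nowhere vanishing derivative. *)
definition smooth_bounded_domain :: "(real^'n) set \<Rightarrow> bool" where
  "smooth_bounded_domain \<Omega> \<longleftrightarrow>
     open \<Omega> \<and> connected \<Omega> \<and> \<Omega> \<noteq> {} \<and> bounded \<Omega> \<and>
     (\<forall>p\<in>frontier \<Omega>. \<exists>U (g :: real^'n \<Rightarrow> real).
        open U \<and> p \<in> U \<and> smooth_on U g \<and>
        (\<forall>x\<in>U. frechet_derivative g (at x) \<noteq> (\<lambda>v. 0)) \<and>
        \<Omega> \<inter> U = {x\<in>U. g x < 0} \<and> frontier \<Omega> \<inter> U = {x\<in>U. g x = 0})"

definition partial_deriv :: "'n \<Rightarrow> (real^'n \<Rightarrow> real) \<Rightarrow> real^'n \<Rightarrow> real" where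
  "partial_deriv i f x = frechet_derivative f (at x) (axis i 1)"

definition infinity_laplacian :: "(real^'n \<Rightarrow> real) \<Rightarrow> real^'n \<Rightarrow> real" where
  "infinity_laplacian f x =
     (\<Sum>i\<in>UNIV. \<Sum>j\<in>UNIV. partial_deriv i f x * partial_deriv j f x *
        partial_deriv j (partial_deriv i f) x)"

definition viscosity_subsolution ::
    "(real^'n) set \<Rightarrow> (real^'n \<Rightarrow> real \<Rightarrow> real) \<Rightarrow> (real^'n \<Rightarrow> real) \<Rightarrow> bool" where
  "viscosity_subsolution \<Omega> f u \<longleftrightarrow> continuous_on \<Omega> u \<and>
     (\<forall>\<phi> x0. Ck_on 2 \<Omega> \<phi> \<longrightarrow> x0 \<in> \<Omega> \<longrightarrow>
        (\<forall>\<^sub>F x in nhds x0. u x - \<phi> x \<le> u x0 - \<phi> x0) \<longrightarrow> \<phi> x0 = u x0 \<longrightarrow>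
        infinity_laplacian \<phi> x0 \<ge> f x0 (\<phi> x0))"

definition viscosity_supersolution ::
    "(real^'n) set \<Rightarrow> (real^'n \<Rightarrow> real \<Rightarrow> real) \<Rightarrow> (real^'n \<Rightarrow> real) \<Rightarrow> bool" where
  "viscosity_supersolution \<Omega> f u \<longleftrightarrow> continuous_on \<Omega> u \<and>
     (\<forall>\<phi> x0. Ck_on 2 \<Omega> \<phi> \<longrightarrow> x0 \<in> \<Omega> \<longrightarrow>
        (\<forall>\<^sub>F x in nhds x0. u x - \<phi> x \<ge> u x0 - \<phi> x0) \<longrightarrow> \<phi> x0 = u x0 \<longrightarrow>
        infinity_laplacian \<phi> x0 \<le> f x0 (\<phi> x0))"

definition viscosity_solution ::
    "(real^'n) set \<Rightarrow> (real^'n \<Rightarrow> real \<Rightarrow> real) \<Rightarrow> (real^'n \<Rightarrow> real) \<Rightarrow> bool" where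
  "viscosity_solution \<Omega> f u \<longleftrightarrow> viscosity_subsolution \<Omega> f u \<and> viscosity_supersolution \<Omega> f u"

definition dirichlet_solution ::
    "(real^'n) set \<Rightarrow> (real^'n \<Rightarrow> real \<Rightarrow> real) \<Rightarrow> (real^'n \<Rightarrow> real) \<Rightarrow> (real^'n \<Rightarrow> real) \<Rightarrow> bool" where
  "dirichlet_solution \<Omega> f \<phi> u \<longleftrightarrow> continuous_on (closure \<Omega>) u \<and> viscosity_solution \<Omega> f u \<and>
     (\<forall>x\<in>frontier \<Omega>. u x = \<phi> x)"

(* The nonlinearity zeta is meaningful only for t >= 0, so an equation with right-hand side
   zeta(x,w) requires w >= 0. *)
definition perron_class ::
    "(real^'n) set \<Rightarrow> (real^'n \<Rightarrow> real \<Rightarrow> real) \<Rightarrow> (real^'n \<Rightarrow> real) \<Rightarrow>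
     (real^'n \<Rightarrow> real) \<Rightarrow> (real^'n \<Rightarrow> real) \<Rightarrow> (real^'n \<Rightarrow> real) set" where
  "perron_class \<Omega> \<zeta> \<phi> ul uu = {w. continuous_on (closure \<Omega>) w \<and> (\<forall>x\<in>closure \<Omega>. 0 \<le> w x) \<and>
     viscosity_supersolution \<Omega> \<zeta> w \<and>
     (\<forall>x\<in>closure \<Omega>. ul x \<le> w x \<and> w x \<le> uu x) \<and> (\<forall>x\<in>frontier \<Omega>. w x = \<phi> x)}"

(* The infimum is taken in the extended reals, where it cannot be an arbitrary value for an empty
   or unbounded family. *)
definition perron_solution ::
    "(real^'n) set \<Rightarrow> (real^'n \<Rightarrow> real \<Rightarrow> real) \<Rightarrow> (real^'n \<Rightarrow> real) \<Rightarrow> (real^'n \<Rightarrow> real) \<Rightarrow> bool" where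
  "perron_solution \<Omega> \<zeta> \<phi> u \<longleftrightarrow> (\<exists>ul uu.
     dirichlet_solution \<Omega> (\<lambda>_ _. SUP (x, t)\<in>\<Omega> \<times> {0..}. \<zeta> x t) \<phi> ul \<and>
     dirichlet_solution \<Omega> (\<lambda>_ _. 0) \<phi> uu \<and>
     (\<forall>x\<in>closure \<Omega>. ereal (u x) = (INF w\<in>perron_class \<Omega> \<zeta> \<phi> ul uu. ereal (w x))))"

definition admissible_boundary_datum ::
    "(real^'n) set \<Rightarrow> real \<Rightarrow> (real^'n \<Rightarrow> real) \<Rightarrow> bool" where
  "admissible_boundary_datum \<Omega> A \<phi> \<longleftrightarrow> continuous_on (closure \<Omega>) \<phi> \<and>
     (\<forall>x\<in>closure \<Omega>. 0 \<le> \<phi> x) \<and> (AE x in lebesgue_on \<Omega>. \<bar>\<phi> x\<bar> \<le> A)"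

definition admissible_nonlinearity ::
    "(real^'n) set \<Rightarrow> real \<Rightarrow> real \<Rightarrow> real \<Rightarrow> real \<Rightarrow> real \<Rightarrow> real \<Rightarrow>
     (real^'n \<Rightarrow> real \<Rightarrow> real) \<Rightarrow> bool" where
  "admissible_nonlinearity \<Omega> B C a b R \<epsilon> \<zeta> \<longleftrightarrow>
     smooth_on (\<Omega> \<times> {0..}) (\<lambda>(x, t). \<zeta> x t) \<and>
     (\<forall>x\<in>\<Omega>. \<forall>t\<ge>0. 0 \<le> \<zeta> x t \<and> \<zeta> x t \<le> B / \<epsilon> * indicat_real {0<..<\<epsilon>} t + C) \<and>
     (INF (x, t)\<in>\<Omega> \<times> {a..b}. \<epsilon> * \<zeta> x (\<epsilon> * t)) = R"

end

theory Submission
  imports Defs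
begin

text \<open>Both inequalities are comparisons with explicit radial barriers. The Perron solution \<open>u\<close> is
  known as a pointwise infimum of supersolutions \<open>w\<close>, so both arguments are carried out on these
  competitors and only then transferred to \<open>u\<close>. The barriers involve \<open>B\<close>, \<open>C\<close>, \<open>b - a\<close> and
  \<open>R\<close> only; the position of \<open>\<Omega>'\<close> inside \<open>\<Omega>\<close> merely limits the radii for which the balls used
  below stay in \<open>\<Omega>\<close>. This is why \<open>c\<close> is universal and \<open>\<rho>0\<close> is not.

  Upper bound. Let \<open>w \<ge> 0\<close> be a competitor whose value at \<open>y\<close> is much larger than \<open>\<rho>\<close>. Put
  under its graph the cone \<open>G (R - norm (x - y))\<close> and let \<open>R\<close> grow from \<open>0\<close> to \<open>2 * \<rho>\<close>. If the
  cone is stopped before, then at the first contact point \<open>w\<close> is touched from below by a radial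
  function whose infinity Laplacian is \<open>G'\<^sup>2 * G''\<close>. The profile \<open>G\<close> is linear with a large slope
  \<open>s\<close>, bent with curvature of order \<open>1 / \<epsilon>\<close> on the layer \<open>0 < G < \<epsilon>\<close>; as this layer has width at
  most \<open>\<epsilon> / s\<close>, the bend changes the slope only by a bounded amount, while \<open>s\<^sup>2 / \<epsilon>\<close> exceeds the
  \<open>B / \<epsilon>\<close> permitted there. So on \<open>{0..}\<close> the product \<open>G'\<^sup>2 * G''\<close> is larger than the equation allows
  (\<open>bent_cone_strict_subsolution\<close>), no contact occurs, and the cone gives
  \<open>w x0 \<ge> s * \<rho>\<close>, which is about \<open>w y / 2\<close> (\<open>supersolution_linear_growth\<close>). Taking infima
  turns this into a bound for \<open>u\<close> (\<open>perron_linear_growth\<close>).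

  Lower bound. There is a smooth radial function that equals \<open>a * \<epsilon>\<close> at \<open>x0\<close>, grows linearly at
  distances of order \<open>\<epsilon>\<close> and beyond, and is a supersolution: it is curved upwards only while its
  values lie in \<open>{a * \<epsilon>..b * \<epsilon>}\<close>, and there \<open>\<zeta>\<close> is at least \<open>R / \<epsilon>\<close>. If \<open>u\<close> were small on a sphere
  around \<open>x0\<close>, then by compactness a single competitor would be small there; replacing it inside
  the sphere by its minimum with the barrier would give another competitor, with value at most
  \<open>a * \<epsilon> < \<epsilon>\<close> at \<open>x0\<close>, contradicting \<open>u x0 > \<epsilon>\<close> (\<open>perron_nondegeneracy\<close>).\<close>

section \<open>The infinity Laplacian of twice differentiable functions\<close>

text \<open>The infinity Laplacian is the second derivative in the direction of the gradient; in this form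
  it can be computed and compared without coordinates.\<close>

lemma infinity_laplacian_second_derivative:
  fixes \<phi> :: "real^'n \<Rightarrow> real"
  assumes "open S" "z \<in> S"
    and d1: "\<And>x. x \<in> S \<Longrightarrow> (\<phi> has_derivative \<phi>' x) (at x)"
    and d2: "\<And>v. ((\<lambda>x. \<phi>' x v) has_derivative \<phi>'' v) (at z)"
  shows "infinity_laplacian \<phi> z = \<phi>'' (\<chi> i. partial_deriv i \<phi> z) (\<chi> i. partial_deriv i \<phi> z)"
proof -
  define p :: "real^'n" where "p = (\<chi> i. partial_deriv i \<phi> z)"
  have pd: "partial_deriv i \<phi> x = \<phi>' x (axis i 1)" if "x \<in> S" for i x
    unfolding partial_deriv_def by (metis d1[OF that] frechet_derivative_at)
  have pd2: "partial_deriv j (partial_deriv i \<phi>) z = \<phi>'' (axis i 1) (axis j 1)" for i j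
  proof -
    have "(partial_deriv i \<phi> has_derivative \<phi>'' (axis i 1)) (at z)"
      by (rule has_derivative_transform_within_open[OF d2 assms(1,2)]) (simp add: pd)
    then show ?thesis
      unfolding partial_deriv_def[of j] by (metis frechet_derivative_at)
  qed
  have pe: "(\<Sum>i\<in>UNIV. p $ i *\<^sub>R axis i 1) = p"
    using basis_expansion[of p] by (simp add: scalar_mult_eq_scaleR)
  have lin1: "\<phi>' x p = (\<Sum>i\<in>UNIV. p $ i * \<phi>' x (axis i 1))" if "x \<in> S" for x
  proof -
    interpret linear "\<phi>' x" using d1[OF that] has_derivative_linear by blast
    have "\<phi>' x p = \<phi>' x (\<Sum>i\<in>UNIV. p $ i *\<^sub>R axis i 1)" by (simp only: pe)
    then show ?thesis by (simp add: sum scaleR)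
  qed
  have lin2: "\<phi>'' v p = (\<Sum>j\<in>UNIV. p $ j * \<phi>'' v (axis j 1))" for v
  proof -
    interpret linear "\<phi>'' v" using d2 has_derivative_linear by blast
    have "\<phi>'' v p = \<phi>'' v (\<Sum>i\<in>UNIV. p $ i *\<^sub>R axis i 1)" by (simp only: pe)
    then show ?thesis by (simp add: sum scaleR)
  qed
  have "((\<lambda>x. \<Sum>i\<in>UNIV. p $ i * \<phi>' x (axis i 1)) has_derivative
          (\<lambda>w. \<Sum>i\<in>UNIV. p $ i * \<phi>'' (axis i 1) w)) (at z)"
    by (intro has_derivative_sum has_derivative_mult_right d2)
  then have "((\<lambda>x. \<phi>' x p) has_derivative (\<lambda>w. \<Sum>i\<in>UNIV. p $ i * \<phi>'' (axis i 1) w)) (at z)"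
    by (rule has_derivative_transform_within_open[OF _ assms(1,2)]) (simp add: lin1)
  from has_derivative_unique[OF d2[of p] this]
  have "\<phi>'' p p = (\<Sum>i\<in>UNIV. p $ i * \<phi>'' (axis i 1) p)" by (rule fun_cong)
  also have "\<dots> = infinity_laplacian \<phi> z"
    unfolding infinity_laplacian_def pd2 lin2 sum_distrib_left
    by (simp add: p_def mult.assoc)
  finally show ?thesis by (simp add: p_def)
qed

lemma Ck_on_2_derivatives:
  fixes \<phi> :: "real^'n \<Rightarrow> real"
  assumes "open S" "Ck_on 2 S \<phi>"
  obtains \<phi>' \<phi>'' where "\<And>x. x \<in> S \<Longrightarrow> (\<phi> has_derivative \<phi>' x) (at x)"
    and "\<And>x v. x \<in> S \<Longrightarrow> ((\<lambda>x. \<phi>' x v) has_derivative \<phi>'' v x) (at x)"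
proof -
  obtain \<phi>' where 1: "\<forall>x\<in>S. (\<phi> has_derivative \<phi>' x) (at x within S)"
     and 2: "\<forall>v. \<exists>\<phi>''. (\<forall>x\<in>S. ((\<lambda>x. \<phi>' x v) has_derivative \<phi>'' x) (at x within S))"
    using assms(2) unfolding numeral_2_eq_2 Ck_on.simps by blast
  from choice[OF 2] obtain \<phi>''
    where "\<forall>v. \<forall>x\<in>S. ((\<lambda>x. \<phi>' x v) has_derivative \<phi>'' v x) (at x within S)"
    by blast
  then have 3: "((\<lambda>x. \<phi>' x v) has_derivative \<phi>'' v x) (at x within S)" if "x \<in> S" for x v
    using that by blast
  show thesis
  proof (rule that)
    show "(\<phi> has_derivative \<phi>' x) (at x)" if "x \<in> S" for x
      using bspec[OF 1 that] by (simp only: at_within_open[OF that assms(1)])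
    show "((\<lambda>x. \<phi>' x v) has_derivative \<phi>'' v x) (at x)" if "x \<in> S" for x v
      using 3[OF that] by (simp only: at_within_open[OF that assms(1)])
  qed
qed

lemma second_derivative_nonneg_at_local_min:
  fixes D :: "real \<Rightarrow> real"
  assumes d1: "\<forall>\<^sub>F s in nhds 0. (D has_real_derivative D' s) (at s)"
    and d2: "(D' has_real_derivative d) (at 0)"
    and "D' 0 = 0"
    and m: "\<forall>\<^sub>F s in nhds 0. D 0 \<le> D s"
  shows "0 \<le> d"
proof (rule ccontr)
  assume "\<not> 0 \<le> d"
  then obtain e1 where e1: "e1 > 0" "\<And>h. 0 < h \<Longrightarrow> h < e1 \<Longrightarrow> D' h < 0"
    using DERIV_neg_dec_right[OF d2] \<open>D' 0 = 0\<close> by auto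
  obtain e2 where e2: "e2 > 0" "\<And>s. dist s 0 < e2 \<Longrightarrow> (D has_real_derivative D' s) (at s)"
    using d1 unfolding eventually_nhds_metric by blast
  obtain e3 where e3: "e3 > 0" "\<And>s. dist s 0 < e3 \<Longrightarrow> D 0 \<le> D s"
    using m unfolding eventually_nhds_metric by blast
  define h where "h = Min {e1, e2, e3} / 2"
  have h: "h > 0" "h < e1" "h < e2" "h < e3"
    using e1(1) e2(1) e3(1) by (auto simp: h_def)
  have "\<exists>\<xi>>0. \<xi> < h \<and> D h - D 0 = (h - 0) * D' \<xi>"
    by (rule MVT2) (use h e2 in auto)
  then obtain \<xi> where \<xi>: "0 < \<xi>" "\<xi> < h" "D h - D 0 = h * D' \<xi>" by auto
  have "D' \<xi> < 0" using e1 \<xi> h by auto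
  then have "D h < D 0" using \<xi>(3) h(1) by (smt (verit) mult_pos_neg)
  with e3(2)[of h] h show False by auto
qed

text \<open>The gradients agree at the contact point, so both infinity Laplacians are second derivatives
  along one and the same line, on which \<open>\<psi> - \<phi>\<close> has a local minimum.\<close>

lemma infinity_laplacian_mono_touching:
  fixes \<phi> \<psi> :: "real^'n \<Rightarrow> real"
  assumes S: "open S" "z \<in> S" and C: "Ck_on 2 S \<phi>" "Ck_on 2 S \<psi>"
    and touch: "\<forall>\<^sub>F x in nhds z. \<phi> x \<le> \<psi> x" "\<phi> z = \<psi> z"
  shows "infinity_laplacian \<phi> z \<le> infinity_laplacian \<psi> z"
proof -
  obtain \<phi>' \<phi>'' where \<phi>: "\<And>x. x \<in> S \<Longrightarrow> (\<phi> has_derivative \<phi>' x) (at x)"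
     "\<And>x v. x \<in> S \<Longrightarrow> ((\<lambda>x. \<phi>' x v) has_derivative \<phi>'' v x) (at x)"
    using Ck_on_2_derivatives[OF S(1) C(1)] by blast
  obtain \<psi>' \<psi>'' where \<psi>: "\<And>x. x \<in> S \<Longrightarrow> (\<psi> has_derivative \<psi>' x) (at x)"
     "\<And>x v. x \<in> S \<Longrightarrow> ((\<lambda>x. \<psi>' x v) has_derivative \<psi>'' v x) (at x)"
    using Ck_on_2_derivatives[OF S(1) C(2)] by blast
  have "((\<lambda>x. \<psi> x - \<phi> x) has_derivative (\<lambda>v. \<psi>' z v - \<phi>' z v)) (at z)"
    by (intro has_derivative_diff \<phi> \<psi> S)
  moreover have "\<forall>\<^sub>F x in at z. \<psi> z - \<phi> z \<le> \<psi> x - \<phi> x"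
    using touch by (auto simp: eventually_at_filter elim: eventually_mono)
  ultimately have "(\<lambda>v. \<psi>' z v - \<phi>' z v) = (\<lambda>v. 0)"
    by (rule has_derivative_local_min)
  then have eqd: "\<psi>' z = \<phi>' z" by (simp add: fun_eq_iff)
  define p where "p = (\<chi> i. partial_deriv i \<phi> z)"
  have p: "p = (\<chi> i. partial_deriv i \<psi> z)"
    unfolding p_def partial_deriv_def
    using frechet_derivative_at[OF \<phi>(1)[OF S(2)]] frechet_derivative_at[OF \<psi>(1)[OF S(2)]] eqd
    by simp
  have lap: "infinity_laplacian \<phi> z = \<phi>'' p z p" "infinity_laplacian \<psi> z = \<psi>'' p z p"
    using infinity_laplacian_second_derivative[of S z \<phi> \<phi>' "\<lambda>v. \<phi>'' v z", OF S \<phi>(1) \<phi>(2)[OF S(2)]]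
      infinity_laplacian_second_derivative[of S z \<psi> \<psi>' "\<lambda>v. \<psi>'' v z", OF S \<psi>(1) \<psi>(2)[OF S(2)]]
    by (auto simp: p_def[symmetric] p[symmetric])
  have lin: "linear (\<psi>'' v z)" "linear (\<phi>'' v z)" "linear (\<phi>' x)" "linear (\<psi>' x)"
    if "x \<in> S" for v x
    using \<phi> \<psi> S that has_derivative_linear by blast+
  define l where "l s = z + s *\<^sub>R p" for s :: real
  have l: "(l has_derivative (\<lambda>h. h *\<^sub>R p)) (at s)" for s
    unfolding l_def by (auto intro!: derivative_eq_intros)
  have lim: "filterlim l (nhds z) (nhds 0)"
    using has_derivative_continuous[OF l, of 0] tendsto_at_iff_tendsto_nhds[of l 0]
    by (simp add: isCont_def l_def)
  have "\<forall>\<^sub>F x in nhds z. x \<in> S" using S by (simp add: eventually_nhds_in_open)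
  then have evS: "\<forall>\<^sub>F s in nhds 0. l s \<in> S"
    using lim by (rule eventually_compose_filterlim)
  have "0 \<le> \<psi>'' p z p - \<phi>'' p z p"
  proof (rule second_derivative_nonneg_at_local_min)
    show "\<forall>\<^sub>F s in nhds 0. ((\<lambda>s. \<psi> (l s) - \<phi> (l s)) has_real_derivative
            (\<psi>' (l s) p - \<phi>' (l s) p)) (at s)"
      using evS
    proof eventually_elim
      case (elim s)
      have "((\<lambda>s. \<psi> (l s) - \<phi> (l s)) has_derivative
             (\<lambda>h. \<psi>' (l s) (h *\<^sub>R p) - \<phi>' (l s) (h *\<^sub>R p))) (at s)"
        by (intro has_derivative_diff has_derivative_compose[OF l] \<phi> \<psi> elim)
      then show ?case
        unfolding has_field_derivative_def
        by (rule has_derivative_eq_rhs)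
          (simp add: lin(3,4)[OF elim] linear_scale algebra_simps fun_eq_iff)
    qed
    have l0: "l 0 = z" by (simp add: l_def)
    have "((\<lambda>s. \<psi>' (l s) p - \<phi>' (l s) p) has_derivative
             (\<lambda>h. \<psi>'' p (l 0) (h *\<^sub>R p) - \<phi>'' p (l 0) (h *\<^sub>R p))) (at 0)"
      by (intro has_derivative_diff has_derivative_compose[OF l] \<phi> \<psi>) (simp_all add: l0 S)
    then show "((\<lambda>s. \<psi>' (l s) p - \<phi>' (l s) p) has_real_derivative (\<psi>'' p z p - \<phi>'' p z p)) (at 0)"
      unfolding has_field_derivative_def
      by (rule has_derivative_eq_rhs)
        (simp add: lin(1,2)[OF S(2)] l0 linear_scale algebra_simps fun_eq_iff)
    show "\<psi>' (l 0) p - \<phi>' (l 0) p = 0" by (simp add: l0 eqd)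
    show "\<forall>\<^sub>F s in nhds 0. \<psi> (l 0) - \<phi> (l 0) \<le> \<psi> (l s) - \<phi> (l s)"
      using eventually_compose_filterlim[OF touch(1) lim] by (simp add: l0 touch(2))
  qed
  then show ?thesis by (simp add: lap)
qed

text \<open>All barriers have the form \<open>f \<circ> q\<close> for a quadratic polynomial \<open>q\<close>, here described by its gradient
  \<open>g\<close> and the constant derivative \<open>H\<close> of \<open>g\<close>. The derivatives of \<open>f\<close> are needed on the range of \<open>q\<close>
  only, so that square roots can occur in \<open>f\<close>.\<close>

lemma
  fixes q :: "real^'n \<Rightarrow> real"
  assumes q: "\<And>x. (q has_derivative (\<lambda>v. g x \<bullet> v)) (at x)"
    and g: "\<And>x. (g has_derivative H) (at x)"
    and f: "\<And>x. (f has_real_derivative f1 (q x)) (at (q x))"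
    and f1: "\<And>x. (f1 has_real_derivative f2 (q x)) (at (q x))"
    and f2: "\<And>x. isCont f2 (q x)"
  shows Ck_on_2_compose: "Ck_on 2 S (\<lambda>x. f (q x))"
    and infinity_laplacian_compose: "infinity_laplacian (\<lambda>x. f (q x)) z =
      (f1 (q z))\<^sup>2 * (f2 (q z) * (g z \<bullet> g z)\<^sup>2 + f1 (q z) * (H (g z) \<bullet> g z))"
proof -
  have linH: "linear H" using g has_derivative_linear by blast
  have d1: "((\<lambda>x. f (q x)) has_derivative (\<lambda>v. f1 (q x) * (g x \<bullet> v))) (at x)" for x
    using has_derivative_compose[OF q[of x] f[of x, unfolded has_field_derivative_def]] .
  have d2: "((\<lambda>x. f1 (q x) * (g x \<bullet> v)) has_derivative
     (\<lambda>w. f2 (q x) * (g x \<bullet> w) * (g x \<bullet> v) + f1 (q x) * (H w \<bullet> v))) (at x)" for x v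
    by (rule has_derivative_eq_rhs,
        rule has_derivative_mult[OF has_derivative_compose[OF q[of x]
            f1[of x, unfolded has_field_derivative_def]] has_derivative_inner_left[OF g[of x]]])
      (simp add: algebra_simps fun_eq_iff)
  have cont: "continuous_on S g" and cq: "isCont q x" for x
    using has_derivative_continuous[OF q] has_derivative_continuous[OF g]
    by (simp_all add: continuous_at_imp_continuous_on)
  have contf: "continuous_on S (\<lambda>x. f2 (q x))" "continuous_on S (\<lambda>x. f1 (q x))"
    using isCont_o2[OF cq f2] isCont_o2[OF cq DERIV_isCont[OF f1]]
    by (simp_all add: continuous_at_imp_continuous_on)
  show "Ck_on 2 S (\<lambda>x. f (q x))"
    unfolding numeral_2_eq_2 Ck_on.simps
  proof (rule exI[of _ "\<lambda>x v. f1 (q x) * (g x \<bullet> v)"], intro conjI ballI allI)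
    show "((\<lambda>x. f (q x)) has_derivative (\<lambda>v. f1 (q x) * (g x \<bullet> v))) (at x within S)" for x
      using d1 has_derivative_at_withinI by blast
    show "\<exists>f'. (\<forall>x\<in>S. ((\<lambda>x. f1 (q x) * (g x \<bullet> v)) has_derivative f' x) (at x within S)) \<and>
          (\<forall>w. continuous_on S (\<lambda>x. f' x w))" for v
      by (rule exI[of _ "\<lambda>x w. f2 (q x) * (g x \<bullet> w) * (g x \<bullet> v) + f1 (q x) * (H w \<bullet> v)"])
        (auto intro!: has_derivative_at_withinI[OF d2] continuous_intros cont contf)
  qed
  have p: "(\<chi> i. partial_deriv i (\<lambda>x. f (q x)) z) = f1 (q z) *\<^sub>R g z"
    unfolding partial_deriv_def frechet_derivative_at[OF d1[of z], symmetric]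
    by (simp add: vec_eq_iff inner_axis)
  show "infinity_laplacian (\<lambda>x. f (q x)) z =
      (f1 (q z))\<^sup>2 * (f2 (q z) * (g z \<bullet> g z)\<^sup>2 + f1 (q z) * (H (g z) \<bullet> g z))"
    using infinity_laplacian_second_derivative[OF open_UNIV UNIV_I d1 d2, of z]
    unfolding p by (simp add: linear_scale[OF linH] power2_eq_square algebra_simps)
qed

section \<open>A supersolution with linear growth\<close>

text \<open>With \<open>r = norm (x - x0) / \<mu>\<close> and \<open>k = sqrt (1 + r\<^sup>2)\<close>, the profile \<open>k + 1 - 2 / k\<close> vanishes at
  \<open>r = 0\<close>, is convex for \<open>r \<le> 1\<close> where its values are at most \<open>1\<close>, and is concave and
  asymptotically linear for \<open>r \<ge> 1\<close>. The term \<open>- 2 / k\<close> overcomes the convexity of \<open>k\<close> at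
  large distances, and because \<open>k\<close> is a smooth function of \<open>r\<^sup>2\<close> the centre is not singular.\<close>

definition dish :: "real \<Rightarrow> real \<Rightarrow> real \<Rightarrow> real^'n \<Rightarrow> real^'n \<Rightarrow> real" where
  "dish c L \<mu> x0 x =
     (let k = sqrt (1 + (norm (x - x0))\<^sup>2 / \<mu>\<^sup>2) in c + L * (k + 1 - 2 / k))"

text \<open>The formula is \<open>h'\<^sup>2 * h''\<close> for the radial profile \<open>h\<close>, written in terms of \<open>k\<close>; away from the centre
  and for \<open>L > 0\<close> its sign is that of \<open>2 - k\<^sup>2\<close>.\<close>

lemma
  fixes x x0 :: "real^'n"
  assumes "\<mu> > 0"
  shows Ck_on_2_dish: "Ck_on 2 S (dish c L \<mu> x0)"
    and infinity_laplacian_dish: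
      "k = sqrt (1 + (norm (x - x0))\<^sup>2 / \<mu>\<^sup>2) \<Longrightarrow> infinity_laplacian (dish c L \<mu> x0) x =
         3 * L^3 * (k\<^sup>2 + 2)\<^sup>2 * (k\<^sup>2 - 1) * (2 - k\<^sup>2) / (\<mu>^4 * k^11)"
proof -
  define q where "q x = (x - x0) \<bullet> (x - x0)" for x :: "real^'n"
  define K where "K w = sqrt (1 + w / \<mu>\<^sup>2)" for w
  define f where "f w = c + L * (K w + 1 - 2 / K w)" for w
  define f1 where "f1 w = L * (1 / K w + 2 / K w ^ 3) / (2 * \<mu>\<^sup>2)" for w
  define f2 where "f2 w = - L * (1 / K w ^ 3 + 6 / K w ^ 5) / (4 * \<mu>^4)" for w
  have q0: "q x \<ge> 0" for x by (simp add: q_def)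
  have Kpos: "K w > 0" if "w \<ge> 0" for w
    using that assms by (simp add: K_def add_pos_nonneg)
  have dK: "(K has_real_derivative 1 / (2 * \<mu>\<^sup>2 * K w)) (at w)" if "w \<ge> 0" for w
  proof -
    have "1 + w / \<mu>\<^sup>2 > 0" using that assms by (simp add: add_pos_nonneg)
    note DERIV_real_sqrt[OF this]
    moreover have "((\<lambda>w. 1 + w / \<mu>\<^sup>2) has_real_derivative 1 / \<mu>\<^sup>2) (at w)"
      using DERIV_add[OF DERIV_const[of 1] DERIV_cdivide[OF DERIV_ident, of "\<mu>\<^sup>2"]] by simp
    ultimately have "((\<lambda>w. sqrt (1 + w / \<mu>\<^sup>2)) has_real_derivative
        (inverse (sqrt (1 + w / \<mu>\<^sup>2)) / 2) * (1 / \<mu>\<^sup>2)) (at w)"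
      by (rule DERIV_chain2)
    moreover have "(\<lambda>w. sqrt (1 + w / \<mu>\<^sup>2)) = K" by (simp add: K_def fun_eq_iff)
    moreover have "inverse (sqrt (1 + w / \<mu>\<^sup>2)) / 2 * (1 / \<mu>\<^sup>2) = 1 / (2 * \<mu>\<^sup>2 * K w)"
      by (simp add: K_def inverse_eq_divide mult.commute mult.left_commute)
    ultimately show ?thesis by simp
  qed
  have df: "(f has_real_derivative f1 w) (at w)" if "w \<ge> 0" for w
  proof -
    have "(f has_real_derivative
        L * (1 / (2 * \<mu>\<^sup>2 * K w) + 2 * (1 / (2 * \<mu>\<^sup>2 * K w)) / (K w)\<^sup>2)) (at w)"
      unfolding f_def using Kpos[OF that]
      by (auto intro!: derivative_eq_intros dK that simp: power2_eq_square)
    also have "L * (1 / (2 * \<mu>\<^sup>2 * K w) + 2 * (1 / (2 * \<mu>\<^sup>2 * K w)) / (K w)\<^sup>2) = f1 w"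
      using Kpos[OF that] assms by (simp add: f1_def field_simps eval_nat_numeral)
    finally show ?thesis .
  qed
  have df1: "(f1 has_real_derivative f2 w) (at w)" if "w \<ge> 0" for w
  proof -
    define D where "D = 1 / (2 * \<mu>\<^sup>2 * K w)"
    have k0: "K w \<noteq> 0" using Kpos[OF that] by simp
    have D: "(K has_real_derivative D) (at w)" unfolding D_def by (rule dK[OF that])
    have "((\<lambda>w. inverse (K w)) has_real_derivative - (D * inverse ((K w)\<^sup>2))) (at w)"
      using DERIV_inverse_fun[OF D k0] by (simp add: power2_eq_square)
    from DERIV_add[OF this DERIV_cmult[OF DERIV_power[OF this, of 3], of 2]]
    have "((\<lambda>w. inverse (K w) + 2 * inverse (K w) ^ 3) has_real_derivative
        - (D * inverse ((K w)\<^sup>2)) + 2 * (3 * inverse (K w) ^ 2 * (- (D * inverse ((K w)\<^sup>2))))) (at w)"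
      by (simp add: mult_ac)
    then have "((\<lambda>w. L / (2 * \<mu>\<^sup>2) * (inverse (K w) + 2 * inverse (K w) ^ 3)) has_real_derivative
        L / (2 * \<mu>\<^sup>2) * (- (D * inverse ((K w)\<^sup>2))
          + 2 * (3 * inverse (K w) ^ 2 * (- (D * inverse ((K w)\<^sup>2)))))) (at w)"
      by (rule DERIV_cmult)
    also have "(\<lambda>w. L / (2 * \<mu>\<^sup>2) * (inverse (K w) + 2 * inverse (K w) ^ 3)) = f1"
      by (simp add: f1_def inverse_eq_divide power_divide fun_eq_iff)
    also have "L / (2 * \<mu>\<^sup>2) * (- (D * inverse ((K w)\<^sup>2))
          + 2 * (3 * inverse (K w) ^ 2 * (- (D * inverse ((K w)\<^sup>2))))) = f2 w"
      using k0 assms by (simp add: f2_def D_def field_simps eval_nat_numeral)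
    finally show ?thesis .
  qed
  have cf2: "isCont f2 w" if "w \<ge> 0" for w
    unfolding f2_def using assms Kpos[OF that] DERIV_isCont[OF dK[OF that]]
    by (auto intro!: continuous_intros)
  have dq: "(q has_derivative (\<lambda>v. 2 *\<^sub>R (x - x0) \<bullet> v)) (at x)" for x
    unfolding q_def by (auto intro!: derivative_eq_intros simp: inner_commute)
  have dg: "((\<lambda>x. 2 *\<^sub>R (x - x0)) has_derivative (\<lambda>v. 2 *\<^sub>R v)) (at x)" for x :: "real^'n"
    by (auto intro!: derivative_eq_intros)
  have dish: "dish c L \<mu> x0 = (\<lambda>x. f (q x))"
    by (simp add: dish_def f_def K_def q_def Let_def power2_norm_eq_inner fun_eq_iff)
  show "Ck_on 2 S (dish c L \<mu> x0)"
    unfolding dish by (rule Ck_on_2_compose[OF dq dg df df1 cf2]) (rule q0)+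
  assume k: "k = sqrt (1 + (norm (x - x0))\<^sup>2 / \<mu>\<^sup>2)"
  have kK: "K (q x) = k" by (simp add: k K_def q_def power2_norm_eq_inner)
  have k0: "k > 0" using kK Kpos[OF q0] by metis
  have qk: "q x = \<mu>\<^sup>2 * (k\<^sup>2 - 1)"
    using assms q0[of x] by (simp add: kK[symmetric] K_def add_nonneg_nonneg)
  have "infinity_laplacian (dish c L \<mu> x0) x =
     (f1 (q x))\<^sup>2 * (f2 (q x) * (4 * q x)\<^sup>2 + f1 (q x) * (8 * q x))"
    unfolding dish
    by (subst infinity_laplacian_compose[OF dq dg df df1 cf2]) (simp_all add: q0, simp add: q_def)
  also have "\<dots> = 3 * L^3 * (k\<^sup>2 + 2)\<^sup>2 * (k\<^sup>2 - 1) * (2 - k\<^sup>2) / (\<mu>^4 * k^11)"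
  proof -
    have a: "f1 (q x) = L * (k\<^sup>2 + 2) / (2 * \<mu>\<^sup>2 * k^3)"
      using k0 assms by (simp add: f1_def kK field_simps eval_nat_numeral)
    have b: "f2 (q x) = - L * (k\<^sup>2 + 6) / (4 * \<mu>^4 * k^5)"
      using k0 assms by (simp add: f2_def kK field_simps eval_nat_numeral)
    have sq: "(4 * (\<mu>\<^sup>2 * (k\<^sup>2 - 1)))\<^sup>2 = 16 * \<mu>^4 * (k\<^sup>2 - 1)\<^sup>2"
      by (simp add: power_mult_distrib flip: power_mult)
    have "- L * (k\<^sup>2 + 6) / (4 * \<mu>^4 * k^5) * (4 * (\<mu>\<^sup>2 * (k\<^sup>2 - 1)))\<^sup>2
        = - 4 * L * (k\<^sup>2 + 6) * (k\<^sup>2 - 1)\<^sup>2 / k^5"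
      unfolding sq using k0 assms by simp
    then have "f2 (q x) * (4 * q x)\<^sup>2 = - 4 * L * (k\<^sup>2 + 6) * (k\<^sup>2 - 1)\<^sup>2 / k^5"
      unfolding b unfolding qk .
    moreover have "L * (k\<^sup>2 + 2) / (2 * \<mu>\<^sup>2 * k^3) * (8 * (\<mu>\<^sup>2 * (k\<^sup>2 - 1)))
        = 4 * L * k\<^sup>2 * (k\<^sup>2 + 2) * (k\<^sup>2 - 1) / k^5"
      using k0 assms by (simp add: divide_simps) (simp add: eval_nat_numeral algebra_simps)
    then have "f1 (q x) * (8 * q x) = 4 * L * k\<^sup>2 * (k\<^sup>2 + 2) * (k\<^sup>2 - 1) / k^5"
      unfolding a unfolding qk .
    ultimately have "f2 (q x) * (4 * q x)\<^sup>2 + f1 (q x) * (8 * q x)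
      = 12 * L * (k\<^sup>2 - 1) * (2 - k\<^sup>2) / k^5"
      using k0 by (simp add: divide_simps) (simp add: eval_nat_numeral algebra_simps)
    note lhs = this
    have sqa: "(L * (k\<^sup>2 + 2) / (2 * \<mu>\<^sup>2 * k^3))\<^sup>2 = L\<^sup>2 * (k\<^sup>2 + 2)\<^sup>2 / (4 * \<mu>^4 * k^6)"
      by (simp add: power_mult_distrib power_divide flip: power_mult)
    have gen: "A\<^sup>2 * P / (4 * X * Y) * (12 * A * Q * S / Z) = (4 * (3 * (A\<^sup>2 * A) * P * Q * S)) / (4 * (X * (Y * Z)))"
      for A P Q S X Y Z :: real by simp
    have "(f1 (q x))\<^sup>2 * (f2 (q x) * (4 * q x)\<^sup>2 + f1 (q x) * (8 * q x))
        = L\<^sup>2 * (k\<^sup>2 + 2)\<^sup>2 / (4 * \<mu>^4 * k^6) * (12 * L * (k\<^sup>2 - 1) * (2 - k\<^sup>2) / k^5)"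
      unfolding lhs unfolding a sqa ..
    also have "\<dots> = (4 * (3 * (L\<^sup>2 * L) * (k\<^sup>2 + 2)\<^sup>2 * (k\<^sup>2 - 1) * (2 - k\<^sup>2))) / (4 * (\<mu>^4 * (k^6 * k^5)))"
      by (rule gen)
    also have "\<dots> = (3 * (L\<^sup>2 * L) * (k\<^sup>2 + 2)\<^sup>2 * (k\<^sup>2 - 1) * (2 - k\<^sup>2)) / (\<mu>^4 * (k^6 * k^5))"
      by (rule mult_divide_mult_cancel_left) simp
    also have "L\<^sup>2 * L = L^3" by (simp add: power2_eq_square power3_eq_cube)
    also have "k^6 * k^5 = k^11" by (simp flip: power_add)
    finally show ?thesis .
  qed
  finally show "infinity_laplacian (dish c L \<mu> x0) x =
         3 * L^3 * (k\<^sup>2 + 2)\<^sup>2 * (k\<^sup>2 - 1) * (2 - k\<^sup>2) / (\<mu>^4 * k^11)" .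
qed

lemma dish_center: "dish c L \<mu> x0 x0 = c"
  by (simp add: dish_def)

lemma dish_ge: "L \<ge> 0 \<Longrightarrow> c \<le> dish c L \<mu> x0 x"
proof -
  assume L: "L \<ge> 0"
  define k where "k = sqrt (1 + (norm (x - x0))\<^sup>2 / \<mu>\<^sup>2)"
  have "k \<ge> 1" by (simp add: k_def)
  then have "2 / k \<le> 2" by (simp add: field_simps)
  with \<open>k \<ge> 1\<close> have "k + 1 - 2 / k \<ge> 0" by simp
  with L show ?thesis by (simp add: dish_def k_def Let_def)
qed

text \<open>A positive infinity Laplacian occurs only where \<open>k\<^sup>2 < 2\<close>, and there the function exceeds its
  value \<open>c\<close> at the centre by at most \<open>L\<close>.\<close>

lemma infinity_laplacian_dish_le:
  fixes x :: "real^'n"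
  assumes "\<mu> > 0" "L > 0"
  shows "infinity_laplacian (dish c L \<mu> x0) x \<le> 48 * L^3 / \<mu>^4"
    and "infinity_laplacian (dish c L \<mu> x0) x \<le> 0 \<or> dish c L \<mu> x0 x \<le> c + L"
proof -
  define k where "k = sqrt (1 + (norm (x - x0))\<^sup>2 / \<mu>\<^sup>2)"
  have k1: "k \<ge> 1" by (simp add: k_def)
  then have k2: "k\<^sup>2 \<ge> 1" by simp
  note lap = infinity_laplacian_dish[OF assms(1) k_def, of c L]
  have neg: "infinity_laplacian (dish c L \<mu> x0) x \<le> 0" if "k\<^sup>2 \<ge> 2"
    unfolding lap using that assms k1 k2
    by (intro divide_nonpos_nonneg mult_nonneg_nonpos mult_nonneg_nonneg) auto
  have le: "k + 1 - 2 / k \<le> 1" if "k\<^sup>2 \<le> 2"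
    using that k1 by (simp add: field_simps power2_eq_square)
  show "infinity_laplacian (dish c L \<mu> x0) x \<le> 0 \<or> dish c L \<mu> x0 x \<le> c + L"
    using neg le assms by (cases "k\<^sup>2 \<ge> 2") (auto simp: dish_def k_def[symmetric] Let_def)
  show "infinity_laplacian (dish c L \<mu> x0) x \<le> 48 * L^3 / \<mu>^4"
  proof (cases "k\<^sup>2 \<ge> 2")
    case True
    then show ?thesis using neg assms by (smt (verit) divide_nonneg_nonneg zero_le_power)
  next
    case False
    then have "(k\<^sup>2 + 2)\<^sup>2 \<le> 4\<^sup>2" by (intro power_mono) auto
    then have "(k\<^sup>2 + 2)\<^sup>2 * ((k\<^sup>2 - 1) * (2 - k\<^sup>2)) \<le> 16 * (1 * 1)"
      using False k2 by (intro mult_mono) auto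
    then have "3 * L^3 * ((k\<^sup>2 + 2)\<^sup>2 * ((k\<^sup>2 - 1) * (2 - k\<^sup>2))) \<le> 3 * L^3 * 16"
      using assms by (intro mult_left_mono) auto
    moreover have "\<mu>^4 * 1 \<le> \<mu>^4 * k^11" using assms k1 by (intro mult_left_mono one_le_power) auto
    ultimately have "3 * L^3 * ((k\<^sup>2 + 2)\<^sup>2 * ((k\<^sup>2 - 1) * (2 - k\<^sup>2))) / (\<mu>^4 * k^11) \<le> 3 * L^3 * 16 / (\<mu>^4 * 1)"
      using assms by (intro frac_le) auto
    then show ?thesis by (simp add: lap mult.assoc)
  qed
qed

text \<open>Since \<open>sqrt (1 + \<tau>\<^sup>2) - 1\<close> is convex in \<open>\<tau>\<close> and vanishes at \<open>0\<close>, it is bounded below by a multiple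
  of \<open>\<tau>\<close> as soon as \<open>\<tau>\<close> stays away from \<open>0\<close>.\<close>

lemma dish_growth:
  assumes "\<mu> > 0" "L \<ge> 0" "t \<ge> 0" "norm (x - x0) \<ge> t * \<mu>"
  shows "dish c L \<mu> x0 x \<ge> c + L * (t / (2 + t) * (norm (x - x0) / \<mu>))"
proof -
  define \<tau> where "\<tau> = norm (x - x0) / \<mu>"
  define \<kappa> where "\<kappa> = t / (2 + t)"
  define k where "k = sqrt (1 + \<tau>\<^sup>2)"
  have \<tau>: "\<tau> \<ge> t" using assms by (simp add: \<tau>_def field_simps)
  have \<kappa>: "0 \<le> \<kappa>" "\<kappa> \<le> 1" "t * (1 - \<kappa>) = 2 * \<kappa>"
    using assms by (auto simp: \<kappa>_def field_simps)
  have "2 * \<kappa> \<le> 2 * \<kappa> * (1 + \<kappa>)" using \<kappa> by (simp add: mult_le_cancel_left1)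
  also have "\<dots> = t * ((1 - \<kappa>) * (1 + \<kappa>))" using \<kappa>(3) by (simp add: mult.assoc[symmetric])
  also have "\<dots> \<le> \<tau> * ((1 - \<kappa>) * (1 + \<kappa>))" using \<tau> \<kappa> by (intro mult_right_mono) auto
  finally have "\<tau> * (2 * \<kappa>) \<le> \<tau> * (\<tau> * ((1 - \<kappa>) * (1 + \<kappa>)))"
    using \<tau> assms by (intro mult_left_mono) auto
  then have "(1 + \<kappa> * \<tau>)\<^sup>2 \<le> 1 + \<tau>\<^sup>2" by (simp add: power2_eq_square algebra_simps)
  then have "1 + \<kappa> * \<tau> \<le> k" unfolding k_def by (rule real_le_rsqrt)
  moreover have "k \<ge> 1" by (simp add: k_def)
  then have "2 / k \<le> 2" by (simp add: field_simps)
  ultimately have "\<kappa> * \<tau> \<le> k + 1 - 2 / k" by simp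
  then have "L * (\<kappa> * \<tau>) \<le> L * (k + 1 - 2 / k)" using assms by (intro mult_left_mono)
  then show ?thesis by (simp add: dish_def k_def \<tau>_def \<kappa>_def Let_def power_divide)
qed

section \<open>Viscosity supersolutions\<close>

lemma infinity_laplacian_add_const: "infinity_laplacian (\<lambda>x. f x + c) = infinity_laplacian f"
proof -
  have "((\<lambda>x. f x + c) has_derivative f') F \<longleftrightarrow> (f has_derivative f') F" for f' F
    using has_derivative_add_const[of f f' F c] has_derivative_add_const[of "\<lambda>x. f x + c" f' F "- c"]
    by auto
  then have "partial_deriv i (\<lambda>x. f x + c) = partial_deriv i f" for i
    by (intro ext) (simp add: partial_deriv_def frechet_derivative_def)
  then show ?thesis by (intro ext) (simp add: infinity_laplacian_def)
qed

lemma Ck_on_add_const: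
  assumes "Ck_on k S f"
  shows "Ck_on k S (\<lambda>x. f x + c)"
proof (cases k)
  case 0
  then show ?thesis using assms by (auto intro!: continuous_intros)
next
  case (Suc m)
  then obtain f' where "\<forall>x\<in>S. (f has_derivative f' x) (at x within S)" "\<forall>v. Ck_on m S (\<lambda>x. f' x v)"
    using assms by auto
  then show ?thesis
    unfolding Suc Ck_on.simps
    by (intro exI[of _ f']) (simp add: has_derivative_add_const)
qed

lemma Ck_on_2_imp_continuous_on: "Ck_on 2 S f \<Longrightarrow> continuous_on S f"
  unfolding numeral_2_eq_2 Ck_on.simps by (auto intro: has_derivative_continuous_on)

lemma viscosity_supersolution_classical:
  assumes "open \<Omega>" and C: "Ck_on 2 \<Omega> \<psi>"
    and lap: "\<And>x. x \<in> \<Omega> \<Longrightarrow> infinity_laplacian \<psi> x \<le> f x (\<psi> x)"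
  shows "viscosity_supersolution \<Omega> f \<psi>"
  unfolding viscosity_supersolution_def
proof (intro conjI allI impI)
  show "continuous_on \<Omega> \<psi>" by (rule Ck_on_2_imp_continuous_on[OF C])
  fix \<phi> x0
  assume *: "Ck_on 2 \<Omega> \<phi>" "x0 \<in> \<Omega>" "\<forall>\<^sub>F x in nhds x0. \<psi> x0 - \<phi> x0 \<le> \<psi> x - \<phi> x" "\<phi> x0 = \<psi> x0"
  then have "\<forall>\<^sub>F x in nhds x0. \<phi> x \<le> \<psi> x" by (auto elim: eventually_mono)
  then have "infinity_laplacian \<phi> x0 \<le> infinity_laplacian \<psi> x0"
    using infinity_laplacian_mono_touching[OF assms(1) _ *(1) C] * by blast
  also have "\<dots> \<le> f x0 (\<phi> x0)" using lap *(2,4) by simp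
  finally show "infinity_laplacian \<phi> x0 \<le> f x0 (\<phi> x0)" .
qed

text \<open>Local form of the principle that minima of supersolutions are supersolutions: a test function
  touching \<open>w\<close> from below also touches \<open>v\<close>. It serves for minima and for gluing two
  supersolutions along a sphere.\<close>

lemma viscosity_supersolution_touched_from_above:
  assumes "continuous_on \<Omega> w"
    and v: "\<And>x. x \<in> \<Omega> \<Longrightarrow>
      \<exists>v. viscosity_supersolution \<Omega> f v \<and> v x = w x \<and> (\<forall>\<^sub>F y in nhds x. w y \<le> v y)"
  shows "viscosity_supersolution \<Omega> f w"
  unfolding viscosity_supersolution_def
proof (intro conjI allI impI)
  fix \<phi> x0
  assume *: "Ck_on 2 \<Omega> \<phi>" "x0 \<in> \<Omega>" "\<forall>\<^sub>F x in nhds x0. w x0 - \<phi> x0 \<le> w x - \<phi> x" "\<phi> x0 = w x0"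
  then obtain v where vv: "viscosity_supersolution \<Omega> f v" "v x0 = w x0" "\<forall>\<^sub>F y in nhds x0. w y \<le> v y"
    using v by blast
  have "\<forall>\<^sub>F x in nhds x0. v x0 - \<phi> x0 \<le> v x - \<phi> x"
    using *(3) vv(3) by eventually_elim (use vv(2) in simp)
  then show "infinity_laplacian \<phi> x0 \<le> f x0 (\<phi> x0)"
    using conjunct2[OF vv(1)[unfolded viscosity_supersolution_def], rule_format, OF *(1,2)] *(4) vv(2)
    by simp
qed fact

lemma viscosity_supersolution_min:
  assumes "viscosity_supersolution \<Omega> f v" "viscosity_supersolution \<Omega> f w"
  shows "viscosity_supersolution \<Omega> f (\<lambda>x. min (v x) (w x))"
proof (rule viscosity_supersolution_touched_from_above)
  show "continuous_on \<Omega> (\<lambda>x. min (v x) (w x))"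
    using assms unfolding viscosity_supersolution_def by (intro continuous_intros) auto
  fix x
  show "\<exists>u. viscosity_supersolution \<Omega> f u \<and> u x = min (v x) (w x) \<and>
      (\<forall>\<^sub>F y in nhds x. min (v y) (w y) \<le> u y)"
    using assms by (cases "v x \<le> w x") (auto simp: min_def)
qed

text \<open>Comparison is immediate when one of the two functions is twice differentiable: at an interior
  maximum of \<open>v - \<psi>\<close>, a vertical translate of \<open>\<psi>\<close> is itself a test function for \<open>v\<close>.\<close>

lemma subsolution_le_strict_supersolution:
  assumes "open \<Omega>" and sub: "viscosity_subsolution \<Omega> (\<lambda>_ _. M) v"
    and K: "compact K" "K \<subseteq> \<Omega>"
    and C: "Ck_on 2 \<Omega> \<psi>"
    and lap: "\<And>x. x \<in> K \<Longrightarrow> infinity_laplacian \<psi> x < M"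
    and bd: "\<And>x. x \<in> frontier K \<Longrightarrow> v x \<le> \<psi> x"
    and x: "x \<in> K"
  shows "v x \<le> \<psi> x"
proof (rule ccontr)
  assume neg: "\<not> v x \<le> \<psi> x"
  have "continuous_on \<Omega> \<psi>" by (rule Ck_on_2_imp_continuous_on[OF C])
  moreover have "continuous_on \<Omega> v" using sub by (simp add: viscosity_subsolution_def)
  ultimately have "continuous_on K (\<lambda>x. v x - \<psi> x)"
    using K(2) by (intro continuous_intros) (auto intro: continuous_on_subset)
  from continuous_attains_sup[OF K(1) _ this] x
  obtain y where y: "y \<in> K" "\<And>z. z \<in> K \<Longrightarrow> v z - \<psi> z \<le> v y - \<psi> y" by blast
  have "v y - \<psi> y > 0" using y(2)[OF x] neg by simp
  then have "y \<in> interior K"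
    using bd[of y] y(1) by (auto simp: frontier_def closure_closed compact_imp_closed[OF K(1)])
  define \<phi> where "\<phi> x = \<psi> x + (v y - \<psi> y)" for x
  have "\<forall>\<^sub>F x in nhds y. x \<in> interior K"
    using \<open>y \<in> interior K\<close> by (simp add: eventually_nhds_in_open)
  then have "\<forall>\<^sub>F x in nhds y. v x - \<phi> x \<le> v y - \<phi> y"
  proof eventually_elim
    case (elim x)
    then show ?case using y(2)[of x] interior_subset[of K] by (auto simp: \<phi>_def)
  qed
  moreover have "Ck_on 2 \<Omega> \<phi>" unfolding \<phi>_def by (rule Ck_on_add_const[OF C])
  moreover have "\<phi> y = v y" by (simp add: \<phi>_def)
  ultimately have "M \<le> infinity_laplacian \<phi> y"
    using conjunct2[OF sub[unfolded viscosity_subsolution_def], rule_format, of \<phi> y] y(1) K(2)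
    by auto
  with lap[OF y(1)] show False
    unfolding \<phi>_def[abs_def] infinity_laplacian_add_const by simp
qed

section \<open>The class of competitors in the Perron infimum\<close>

lemma perron_class_min:
  assumes "v \<in> perron_class \<Omega> \<zeta> \<phi> ul uu" "w \<in> perron_class \<Omega> \<zeta> \<phi> ul uu"
  shows "(\<lambda>x. min (v x) (w x)) \<in> perron_class \<Omega> \<zeta> \<phi> ul uu"
  using assms unfolding perron_class_def
  by (auto intro!: continuous_intros viscosity_supersolution_min min.coboundedI1)

text \<open>A Dini type argument: competitors are continuous, so a strict bound at a point persists nearby,
  and finitely many competitors covering \<open>K\<close> can be replaced by their minimum.\<close>

lemma perron_class_uniformly_below:
  assumes u: "\<And>x. x \<in> closure \<Omega> \<Longrightarrow>
      ereal (u x) = (INF w\<in>perron_class \<Omega> \<zeta> \<phi> ul uu. ereal (w x))"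
    and "open \<Omega>" "\<Omega> \<noteq> {}" "compact K" "K \<subseteq> \<Omega>" and below: "\<And>x. x \<in> K \<Longrightarrow> u x < \<alpha>"
  obtains w where "w \<in> perron_class \<Omega> \<zeta> \<phi> ul uu" "\<And>x. x \<in> K \<Longrightarrow> w x < \<alpha>"
proof -
  let ?P = "perron_class \<Omega> \<zeta> \<phi> ul uu"
  define V where "V w = {x \<in> \<Omega>. w x < \<alpha>}" for w :: "real^'a \<Rightarrow> real"
  have "open (V w)" if "w \<in> ?P" for w
  proof -
    have "continuous_on \<Omega> w"
      using that unfolding perron_class_def viscosity_supersolution_def by blast
    then have "open (\<Omega> \<inter> w -` {..<\<alpha>})"
      using \<open>open \<Omega>\<close> by (intro continuous_open_preimage) auto
    moreover have "V w = \<Omega> \<inter> w -` {..<\<alpha>}" by (auto simp: V_def)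
    ultimately show ?thesis by simp
  qed
  moreover have "K \<subseteq> (\<Union>w\<in>?P. V w)"
  proof
    fix x assume x: "x \<in> K"
    with \<open>K \<subseteq> \<Omega>\<close> have "x \<in> \<Omega>" by blast
    then have "(INF w\<in>?P. ereal (w x)) = ereal (u x)" using u closure_subset by (metis subsetD)
    with below[OF x] have "(INF w\<in>?P. ereal (w x)) < ereal \<alpha>" by simp
    then obtain w where "w \<in> ?P" "w x < \<alpha>" unfolding INF_less_iff by auto
    with \<open>x \<in> \<Omega>\<close> show "x \<in> (\<Union>w\<in>?P. V w)" by (auto simp: V_def)
  qed
  ultimately obtain F where F: "F \<subseteq> ?P" "finite F" "K \<subseteq> (\<Union>w\<in>F. V w)"
    using compactE_image[OF \<open>compact K\<close>] by metis
  from \<open>\<Omega> \<noteq> {}\<close> obtain x where "x \<in> \<Omega>" by blast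
  then have "(INF w\<in>?P. ereal (w x)) = ereal (u x)" using u closure_subset by (metis subsetD)
  then have "?P \<noteq> {}" by (auto simp: top_ereal_def)
  have "\<exists>w\<in>?P. \<forall>x\<in>(\<Union>w\<in>F. V w). w x < \<alpha>"
    using F(2,1)
  proof (induction F rule: finite_induct)
    case empty
    then show ?case using \<open>?P \<noteq> {}\<close> by auto
  next
    case (insert w F)
    then obtain v where v: "v \<in> ?P" "\<forall>x\<in>(\<Union>w\<in>F. V w). v x < \<alpha>" by auto
    have "(\<lambda>x. min (w x) (v x)) \<in> ?P"
      using v(1) insert.prems by (intro perron_class_min) auto
    moreover have "\<forall>x\<in>(\<Union>w\<in>insert w F. V w). min (w x) (v x) < \<alpha>"
      using v(2) by (auto simp: V_def min_less_iff_disj)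
    ultimately show ?case by (intro bexI[of _ "\<lambda>x. min (w x) (v x)"])
  qed
  then obtain w where w: "w \<in> ?P" "\<forall>x\<in>(\<Union>w\<in>F. V w). w x < \<alpha>" by (rule bexE)
  show thesis
  proof (rule that[OF w(1)])
    show "w x < \<alpha>" if "x \<in> K" for x using w(2) subsetD[OF F(3) that] by (rule bspec)
  qed
qed

section \<open>Radial functions touching a supersolution from below\<close>

text \<open>The quadratic polynomial on the right is exact along the line through \<open>e\<close>. Hence it may replace
  the norm in a test function, where it has the right first and second derivatives in the
  direction of the gradient and no singularity.\<close>

lemma norm_le_quadratic:
  fixes h e :: "'a::real_inner"
  assumes "r > 0" "norm e = 1" "e \<bullet> h \<ge> - r / 2"
  shows "norm (h + r *\<^sub>R e) \<le> r + e \<bullet> h + (h \<bullet> h - (e \<bullet> h)\<^sup>2) / r"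
proof -
  define \<alpha> \<beta> where "\<alpha> = e \<bullet> h" and "\<beta> = h \<bullet> h - \<alpha>\<^sup>2"
  have ee: "e \<bullet> e = 1" using assms(2) by (simp add: dot_square_norm)
  have \<beta>: "\<beta> \<ge> 0" using Cauchy_Schwarz_ineq[of e h] by (simp add: \<beta>_def \<alpha>_def ee)
  have "(norm (h + r *\<^sub>R e))\<^sup>2 = (r + \<alpha>)\<^sup>2 + \<beta>"
    unfolding power2_norm_eq_inner
    by (simp add: inner_simps \<beta>_def \<alpha>_def ee inner_commute power2_eq_square algebra_simps)
  also have "\<beta> \<le> 2 * (r + \<alpha>) * (\<beta> / r)"
  proof -
    have "r * \<beta> \<le> 2 * (r + \<alpha>) * \<beta>" using assms(3) \<beta> by (intro mult_right_mono) (auto simp: \<alpha>_def)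
    then show ?thesis using assms(1) by (simp add: field_simps)
  qed
  also have "(r + \<alpha>)\<^sup>2 + 2 * (r + \<alpha>) * (\<beta> / r) \<le> (r + \<alpha> + \<beta> / r)\<^sup>2"
    using zero_le_power2[of "\<beta> / r"] by (simp only: power2_sum)
  finally have "(norm (h + r *\<^sub>R e))\<^sup>2 \<le> (r + \<alpha> + \<beta> / r)\<^sup>2" by simp
  moreover have "r + \<alpha> + \<beta> / r \<ge> 0" using assms \<beta> by (auto simp: \<alpha>_def intro!: add_nonneg_nonneg)
  ultimately have "norm (h + r *\<^sub>R e) \<le> r + \<alpha> + \<beta> / r" by (rule power2_le_imp_le)
  then show ?thesis by (simp only: \<beta>_def \<alpha>_def)
qed

text \<open>The singularity of the norm at \<open>y\<close> prevents \<open>G (T - norm (x - y))\<close> from being a test function.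
  Replacing the norm by the quadratic polynomial above gives, because \<open>G\<close> is monotone, a
  smaller function near the contact point, which is free of the singularity and has the same infinity Laplacian at the contact point.\<close>

lemma supersolution_touched_by_radial:
  fixes y z :: "real^'n"
  assumes "open \<Omega>" "z \<in> \<Omega>" "z \<noteq> y" and sup: "viscosity_supersolution \<Omega> f v"
    and G: "\<And>t. (G has_real_derivative G1 t) (at t)" "\<And>t. (G1 has_real_derivative G2 t) (at t)"
      "\<And>t. isCont G2 t" and mono: "mono G"
    and touch: "v z = G (T - norm (z - y))" "\<forall>\<^sub>F x in nhds z. G (T - norm (x - y)) \<le> v x"
  shows "(G1 (T - norm (z - y)))\<^sup>2 * G2 (T - norm (z - y)) \<le> f z (v z)"
proof -
  define r where "r = norm (z - y)"
  define e where "e = (z - y) /\<^sub>R r"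
  have r: "r > 0" using assms(3) by (simp add: r_def)
  have e: "norm e = 1" "z - y = r *\<^sub>R e" using r by (auto simp: e_def r_def)
  have ee: "e \<bullet> e = 1" using e(1) by (simp add: dot_square_norm)
  \<comment> \<open>The polynomial of \<open>norm_le_quadratic\<close> with \<open>h = x - z\<close>; its second derivative kills \<open>e\<close>.\<close>
  define q where "q x = r + e \<bullet> (x - z) + ((x - z) \<bullet> (x - z) - (e \<bullet> (x - z))\<^sup>2) / r" for x
  define g where "g x = e + (2 / r) *\<^sub>R ((x - z) - (e \<bullet> (x - z)) *\<^sub>R e)" for x
  define H where "H v = (2 / r) *\<^sub>R (v - (e \<bullet> v) *\<^sub>R e)" for v
  have "(q has_derivative (\<lambda>v. e \<bullet> v + (2 * ((x - z) \<bullet> v) - 2 * (e \<bullet> (x - z)) * (e \<bullet> v)) / r)) (at x)" for x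
    unfolding q_def using r by (auto intro!: derivative_eq_intros simp: inner_commute fun_eq_iff)
  then have q: "(q has_derivative (\<lambda>v. g x \<bullet> v)) (at x)" for x
    by (rule has_derivative_eq_rhs) (simp add: g_def inner_simps fun_eq_iff diff_divide_distrib)
  have g: "(g has_derivative H) (at x)" for x
    unfolding g_def[abs_def] H_def[abs_def] by (auto intro!: derivative_eq_intros simp: fun_eq_iff)
  have refl: "((\<lambda>w. T - w) has_real_derivative - 1) (at w)" for w :: real
    by (auto intro!: derivative_eq_intros)
  have d1: "((\<lambda>w. G (T - w)) has_real_derivative - G1 (T - w)) (at w)" for w
    using DERIV_chain2[OF G(1) refl] by simp
  have d2: "((\<lambda>w. - G1 (T - w)) has_real_derivative G2 (T - w)) (at w)" for w
    using DERIV_minus[OF DERIV_chain2[OF G(2) refl]] by simp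
  have d3: "isCont (\<lambda>w. G2 (T - w)) w" for w
    by (rule isCont_o2[OF DERIV_isCont[OF refl] G(3)])
  note comp = q g d1 d2 d3
  have C: "Ck_on 2 \<Omega> (\<lambda>x. G (T - q x))" by (rule Ck_on_2_compose[OF comp])
  have qz: "q z = r" "g z = e" "H e = 0" by (simp_all add: q_def g_def H_def ee)
  have lap: "infinity_laplacian (\<lambda>x. G (T - q x)) z = (G1 (T - r))\<^sup>2 * G2 (T - r)"
    by (subst infinity_laplacian_compose[OF comp]) (simp add: qz ee)
  have "((\<lambda>x. e \<bullet> (x - z)) \<longlongrightarrow> e \<bullet> (z - z)) (nhds z)"
    by (intro tendsto_intros filterlim_ident)
  then have "\<forall>\<^sub>F x in nhds z. - r / 2 < e \<bullet> (x - z)"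
    using r by (intro order_tendstoD(1)) auto
  with touch(2) have "\<forall>\<^sub>F x in nhds z. v z - G (T - q z) \<le> v x - G (T - q x)"
  proof eventually_elim
    case (elim x)
    have "norm (x - y) \<le> q x"
      using norm_le_quadratic[OF r e(1), of "x - z"] elim(2) e(2)[symmetric] by (simp add: q_def)
    then have "G (T - q x) \<le> G (T - norm (x - y))" by (intro monoD[OF mono]) simp
    then show ?case using elim(1) touch(1) by (simp add: qz r_def)
  qed
  moreover have "G (T - q z) = v z" using touch(1) by (simp add: qz r_def)
  ultimately have "infinity_laplacian (\<lambda>x. G (T - q x)) z \<le> f z (v z)"
    using conjunct2[OF sup[unfolded viscosity_supersolution_def], rule_format, OF C assms(2)] by simp
  then show ?thesis by (simp add: lap r_def)
qed

text \<open>The equation is not monotone in the unknown, so the barrier must touch \<open>v\<close> at equal height: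
  vertical translation would change the value at which the right-hand side is evaluated. The
  cone is therefore enlarged horizontally, and \<open>R\<close> is the smallest size at which it reaches the
  graph of \<open>v\<close>.\<close>

lemma first_contact:
  fixes y :: "'a::euclidean_space" and v :: "'a \<Rightarrow> real"
  assumes K: "compact K" "continuous_on K v" "\<And>x. x \<in> K \<Longrightarrow> 0 \<le> v x"
    and G: "continuous_on UNIV G" "strict_mono G" "G 0 = (0::real)"
    and T: "T \<ge> 0" and x1: "x1 \<in> K" "v x1 < G (T - norm (x1 - y))"
  obtains z R where "z \<in> K" "norm (z - y) \<le> R" "R \<le> T" "v z = G (R - norm (z - y))"
    "\<And>x. x \<in> K \<Longrightarrow> G (R - norm (x - y)) \<le> v x"
proof -
  define P where "P = {p \<in> K \<times> {0..T}. v (fst p) - G (snd p - norm (fst p - y)) \<le> 0}"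
  have ck: "compact (K \<times> {0..T})" by (intro compact_Times K compact_Icc)
  have "continuous_on (K \<times> {0..T}) (\<lambda>p. v (fst p) - G (snd p - norm (fst p - y)))"
    by (intro continuous_intros continuous_on_compose2[OF K(2)] continuous_on_compose2[OF G(1)]) auto
  then have "closed ((K \<times> {0..T}) \<inter> (\<lambda>p. v (fst p) - G (snd p - norm (fst p - y))) -` {..0})"
    by (rule continuous_closed_preimage) (use ck compact_imp_closed in auto)
  moreover have "P = (K \<times> {0..T}) \<inter> (\<lambda>p. v (fst p) - G (snd p - norm (fst p - y))) -` {..0}"
    by (auto simp: P_def)
  ultimately have "closed P" by simp
  then have "compact ((K \<times> {0..T}) \<inter> P)" by (rule compact_Int_closed[OF ck])
  moreover have "(K \<times> {0..T}) \<inter> P = P" by (auto simp: P_def)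
  ultimately have "compact P" by simp
  moreover have "(x1, T) \<in> P" using x1 T by (auto simp: P_def)
  then have "P \<noteq> {}" by blast
  ultimately have "\<exists>p\<in>P. \<forall>p'\<in>P. snd p \<le> snd p'"
    by (rule continuous_attains_inf) (rule continuous_on_snd[OF continuous_on_id])
  then obtain p where p: "p \<in> P" "\<And>p'. p' \<in> P \<Longrightarrow> snd p \<le> snd p'" by blast
  obtain z R where zR: "p = (z, R)" by (cases p)
  have z: "z \<in> K" "0 \<le> R" "R \<le> T" "v z \<le> G (R - norm (z - y))" using p(1) by (auto simp: P_def zR)
  have below: "G (R - norm (x - y)) \<le> v x" if xK: "x \<in> K" for x
  proof (rule ccontr)
    assume "\<not> G (R - norm (x - y)) \<le> v x"
    then have lt: "v x < G (R - norm (x - y))" by simp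
    then have "G 0 < G (R - norm (x - y))" using K(3)[OF xK] G(3) by simp
    then have pos: "0 < R - norm (x - y)" using strict_mono_less[OF G(2)] by blast
    \<comment> \<open>If the cone of size \<open>R\<close> were above \<open>v\<close> at \<open>x\<close>, a smaller one would already meet \<open>v\<close> there.\<close>
    then obtain t where t: "0 \<le> t" "t \<le> R - norm (x - y)" "G t = v x"
      using IVT'[of G 0 "v x" "R - norm (x - y)"] lt K(3)[OF xK] G(3)
        continuous_on_subset[OF G(1)] by auto
    have "t \<noteq> R - norm (x - y)" using t(3) lt by auto
    with t have "t + norm (x - y) < R" by simp
    moreover have "(x, t + norm (x - y)) \<in> P" using t xK z(3) calculation by (auto simp: P_def)
    ultimately show False using p(2) zR by force
  qed
  have eq: "v z = G (R - norm (z - y))" using below[OF z(1)] z(4) by simp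
  then have "G 0 \<le> G (R - norm (z - y))" using K(3)[OF z(1)] G(3) by simp
  then have "norm (z - y) \<le> R" using strict_mono_less_eq[OF G(2)] by simp
  from that[OF z(1) this z(3) eq below] show thesis .
qed

section \<open>Linear growth of supersolutions\<close>

text \<open>The square root provides curvature of order \<open>1 / \<epsilon>\<close> for \<open>\<bar>t\<bar> \<le> \<epsilon>\<close> at the price of a slope of
  modulus at most \<open>1\<close>; the exponential provides curvature at least \<open>1\<close> for all \<open>t \<ge> 0\<close> and keeps
  the profile strictly increasing on the whole line when \<open>s \<ge> 1\<close>.\<close>

definition bent_cone :: "real \<Rightarrow> real \<Rightarrow> real \<Rightarrow> real" where
  "bent_cone s \<epsilon> t = s * t + (sqrt (\<epsilon>\<^sup>2 + t\<^sup>2) - \<epsilon>) + (exp t - 1)"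

definition bent_cone' :: "real \<Rightarrow> real \<Rightarrow> real \<Rightarrow> real" where
  "bent_cone' s \<epsilon> t = s + t / sqrt (\<epsilon>\<^sup>2 + t\<^sup>2) + exp t"

definition bent_cone'' :: "real \<Rightarrow> real \<Rightarrow> real" where
  "bent_cone'' \<epsilon> t = \<epsilon>\<^sup>2 / sqrt (\<epsilon>\<^sup>2 + t\<^sup>2) ^ 3 + exp t"

lemma
  assumes "\<epsilon> > 0"
  shows bent_cone_deriv: "(bent_cone s \<epsilon> has_real_derivative bent_cone' s \<epsilon> t) (at t)"
    and bent_cone'_deriv: "(bent_cone' s \<epsilon> has_real_derivative bent_cone'' \<epsilon> t) (at t)"
    and isCont_bent_cone'': "isCont (bent_cone'' \<epsilon>) t"
proof -
  define S where "S t = sqrt (\<epsilon>\<^sup>2 + t\<^sup>2)" for t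
  have pos: "\<epsilon>\<^sup>2 + t\<^sup>2 > 0" for t using assms by (simp add: add_pos_nonneg)
  have S: "S t > 0" "(S t)\<^sup>2 = \<epsilon>\<^sup>2 + t\<^sup>2" for t using pos[of t] by (auto simp: S_def)
  have dS: "(S has_real_derivative t / S t) (at t)" for t
  proof -
    have "((\<lambda>t. \<epsilon>\<^sup>2 + t\<^sup>2) has_real_derivative 2 * t) (at t)"
      by (auto intro!: derivative_eq_intros)
    from DERIV_chain2[OF DERIV_real_sqrt[OF pos] this]
    have "(S has_real_derivative inverse (S t) / 2 * (2 * t)) (at t)" by (simp add: S_def[abs_def])
    also have "inverse (S t) / 2 * (2 * t) = t / S t" by (simp add: inverse_eq_divide)
    finally show ?thesis .
  qed
  have "((\<lambda>t. s * t + (S t - \<epsilon>) + (exp t - 1)) has_real_derivative s + t / S t + exp t) (at t)"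
    by (rule derivative_eq_intros dS refl | simp)+
  then show "(bent_cone s \<epsilon> has_real_derivative bent_cone' s \<epsilon> t) (at t)"
    by (simp add: bent_cone_def[abs_def] bent_cone'_def S_def)
  have dq: "((\<lambda>t. t / S t) has_real_derivative \<epsilon>\<^sup>2 / S t ^ 3) (at t)"
  proof -
    have "((\<lambda>t. t / S t) has_real_derivative (1 * S t - t * (t / S t)) / (S t * S t)) (at t)"
      by (rule DERIV_divide[OF DERIV_ident dS]) (use S(1)[of t] in simp)
    also have "(1 * S t - t * (t / S t)) / (S t * S t) = ((S t)\<^sup>2 - t\<^sup>2) / S t ^ 3"
      using S(1)[of t] by (simp add: field_simps eval_nat_numeral)
    also have "(S t)\<^sup>2 - t\<^sup>2 = \<epsilon>\<^sup>2" by (simp add: S(2))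
    finally show ?thesis .
  qed
  have "((\<lambda>t. s + t / S t + exp t) has_real_derivative \<epsilon>\<^sup>2 / S t ^ 3 + exp t) (at t)"
    by (rule derivative_eq_intros dq refl | simp)+
  then show "(bent_cone' s \<epsilon> has_real_derivative bent_cone'' \<epsilon> t) (at t)"
    by (simp add: bent_cone'_def[abs_def] bent_cone''_def S_def)
  have "isCont (\<lambda>t. \<epsilon>\<^sup>2 / S t ^ 3 + exp t) t"
    using DERIV_isCont[OF dS] S(1)[of t] by (intro continuous_intros) auto
  then show "isCont (bent_cone'' \<epsilon>) t" by (simp add: bent_cone''_def[abs_def] S_def)
qed

lemma bent_cone_0: "\<epsilon> > 0 \<Longrightarrow> bent_cone s \<epsilon> 0 = 0"
  by (simp add: bent_cone_def)

lemma strict_mono_bent_cone: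
  assumes "\<epsilon> > 0" "s \<ge> 1"
  shows "strict_mono (bent_cone s \<epsilon>)"
proof (rule strict_monoI)
  fix x y :: real assume "x < y"
  then show "bent_cone s \<epsilon> x < bent_cone s \<epsilon> y"
  proof (rule DERIV_pos_imp_increasing)
    fix t :: real
    have S: "sqrt (\<epsilon>\<^sup>2 + t\<^sup>2) > 0" using assms(1) by (simp add: add_pos_nonneg)
    have "- t \<le> sqrt (\<epsilon>\<^sup>2 + t\<^sup>2)" by (rule real_le_rsqrt) simp
    then have "t / sqrt (\<epsilon>\<^sup>2 + t\<^sup>2) \<ge> - 1" using S by (simp add: field_simps)
    then have "bent_cone' s \<epsilon> t > 0"
      unfolding bent_cone'_def using assms(2) exp_gt_zero[of t] by linarith
    then show "\<exists>y. (bent_cone s \<epsilon> has_real_derivative y) (at t) \<and> 0 < y"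
      using bent_cone_deriv[OF assms(1)] by blast
  qed
qed

lemma bent_cone_ge:
  assumes "\<epsilon> > 0" "t \<ge> 0"
  shows "s * t \<le> bent_cone s \<epsilon> t"
proof -
  have "\<epsilon> \<le> sqrt (\<epsilon>\<^sup>2 + t\<^sup>2)" by (rule real_le_rsqrt) simp
  moreover have "1 \<le> exp t" using assms(2) by simp
  ultimately show ?thesis unfolding bent_cone_def by linarith
qed

lemma bent_cone_less:
  assumes "\<epsilon> > 0" "0 < t" "t \<le> 1"
  shows "bent_cone s \<epsilon> t < (s + 3) * t"
proof -
  have "sqrt (\<epsilon>\<^sup>2 + t\<^sup>2) < \<epsilon> + t"
    using assms by (intro real_less_lsqrt) (auto simp: power2_sum)
  moreover have "exp t \<le> 1 + t + t\<^sup>2" using assms exp_bound by simp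
  moreover have "t\<^sup>2 \<le> t" using assms by (simp add: power2_eq_square mult_left_le)
  ultimately show ?thesis by (simp add: bent_cone_def algebra_simps)
qed

text \<open>If the value of the profile lies in \<open>{0<..<\<epsilon>}\<close>, then \<open>t < \<epsilon>\<close> because the slope is at least \<open>1\<close>, so
  the curvature \<open>\<epsilon>\<^sup>2 / sqrt (\<epsilon>\<^sup>2 + t\<^sup>2) ^ 3\<close> of the bend is at least \<open>1 / (8 * \<epsilon>)\<close>; the square of the
  slope then beats \<open>B\<close>. The exponential alone beats \<open>C\<close>.\<close>

lemma bent_cone_strict_subsolution:
  assumes "\<epsilon> > 0" "B \<ge> 0" "C \<ge> 0" "s \<ge> 3 * (1 + B + C)" "t \<ge> 0"
  shows "B / \<epsilon> * indicat_real {0<..<\<epsilon>} (bent_cone s \<epsilon> t) + C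
           < (bent_cone' s \<epsilon> t)\<^sup>2 * bent_cone'' \<epsilon> t"
proof -
  define S where "S = sqrt (\<epsilon>\<^sup>2 + t\<^sup>2)"
  define D where "D = 1 + B + C"
  have S: "S > 0" using assms(1) by (simp add: S_def add_pos_nonneg)
  have D: "D \<ge> 1" "D \<le> D\<^sup>2" using assms(2,3) by (auto simp: D_def power2_eq_square mult_le_cancel_left1)
  have "s \<le> bent_cone' s \<epsilon> t"
    unfolding bent_cone'_def S_def[symmetric] using S assms(5) by (simp add: add_nonneg_nonneg)
  moreover have "3 * D \<le> s" using assms(4) by (simp add: D_def)
  ultimately have "(3 * D)\<^sup>2 \<le> (bent_cone' s \<epsilon> t)\<^sup>2" using D by (intro power_mono) auto
  then have g1: "9 * D \<le> (bent_cone' s \<epsilon> t)\<^sup>2" using D(2) by (simp add: power_mult_distrib)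
  define X where "X = \<epsilon>\<^sup>2 / S ^ 3"
  have X: "X \<ge> 0" using S by (simp add: X_def)
  have "B / \<epsilon> * indicat_real {0<..<\<epsilon>} (bent_cone s \<epsilon> t) \<le> 9 * D * X"
  proof (cases "bent_cone s \<epsilon> t \<in> {0<..<\<epsilon>}")
    case True
    have "1 * t \<le> s * t" using assms(5) \<open>3 * D \<le> s\<close> D(1) by (intro mult_right_mono) auto
    also have "\<dots> \<le> bent_cone s \<epsilon> t" using bent_cone_ge assms by blast
    also have "\<dots> < \<epsilon>" using True by simp
    finally have "t\<^sup>2 \<le> \<epsilon>\<^sup>2" using assms(5) by (intro power_mono) auto
    moreover have "(2 * \<epsilon>)\<^sup>2 = 4 * \<epsilon>\<^sup>2" by (simp add: power_mult_distrib)
    ultimately have "\<epsilon>\<^sup>2 + t\<^sup>2 \<le> (2 * \<epsilon>)\<^sup>2" using zero_le_power2[of \<epsilon>] by linarith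
    then have "S \<le> 2 * \<epsilon>"
      unfolding S_def using assms(1) by (intro real_le_lsqrt) simp_all
    then have "S ^ 3 \<le> (2 * \<epsilon>) ^ 3" using S by (intro power_mono) auto
    then have "\<epsilon>\<^sup>2 / (2 * \<epsilon>) ^ 3 \<le> X" unfolding X_def using S assms(1) by (intro divide_left_mono) auto
    moreover have "\<epsilon>\<^sup>2 / (2 * \<epsilon>) ^ 3 = 1 / (8 * \<epsilon>)"
      using assms(1) by (simp add: field_simps eval_nat_numeral)
    ultimately have "9 * D * (1 / (8 * \<epsilon>)) \<le> 9 * D * X" using D(1) by (intro mult_left_mono) auto
    moreover have "B / \<epsilon> \<le> 9 * D * (1 / (8 * \<epsilon>))"
      using assms(1-3) by (simp add: D_def field_simps)
    ultimately show ?thesis using True by simp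
  qed (use D X in simp)
  moreover have "C < 9 * D * 1" using assms(2,3) by (simp add: D_def)
  moreover have "9 * D * 1 \<le> 9 * D * exp t" using D assms(5) by (intro mult_left_mono) auto
  ultimately have "B / \<epsilon> * indicat_real {0<..<\<epsilon>} (bent_cone s \<epsilon> t) + C < 9 * D * (X + exp t)"
    by (simp add: distrib_left)
  also have "\<dots> \<le> (bent_cone' s \<epsilon> t)\<^sup>2 * (X + exp t)"
    using g1 X by (intro mult_right_mono) (auto intro: add_nonneg_nonneg)
  finally show ?thesis by (simp add: bent_cone''_def X_def S_def)
qed

text \<open>A Harnack type inequality whose constant does not feel the singular layer: a large value at \<open>y\<close>
  supports a steep cone below \<open>v\<close>, and this cone reaches \<open>x0\<close>.\<close>

lemma supersolution_linear_growth:
  fixes x0 y :: "real^'n"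
  assumes "open \<Omega>" and sup: "viscosity_supersolution \<Omega> \<zeta> v"
    and \<zeta>: "\<And>x t. x \<in> \<Omega> \<Longrightarrow> t \<ge> 0 \<Longrightarrow> \<zeta> x t \<le> B / \<epsilon> * indicat_real {0<..<\<epsilon>} t + C"
    and pos: "\<epsilon> > 0" "B \<ge> 0" "C \<ge> 0"
    and \<rho>: "0 < \<rho>" "\<rho> \<le> 1 / 2" "cball y (3 * \<rho>) \<subseteq> \<Omega>"
    and v: "\<And>x. x \<in> cball y (3 * \<rho>) \<Longrightarrow> 0 \<le> v x"
    and x0: "norm (x0 - y) \<le> \<rho>"
  shows "v y \<le> (12 + 6 * B + 6 * C) * (\<rho> + v x0)"
proof -
  define k where "k = 12 + 6 * B + 6 * C"
  have k: "k \<ge> 12" using pos by (simp add: k_def)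
  have x0K: "x0 \<in> cball y (3 * \<rho>)" using x0 \<rho>(1) by (simp add: dist_norm norm_minus_commute)
  have v0: "v x0 \<ge> 0" by (rule v[OF x0K])
  show ?thesis
  proof (cases "v y \<le> k * \<rho>")
    case True
    also have "k * \<rho> \<le> k * (\<rho> + v x0)" using k v0 by (intro mult_left_mono) auto
    finally show ?thesis by (simp add: k_def)
  next
    case False
    \<comment> \<open>A slope for which the cone of size \<open>2 * \<rho>\<close> stays below \<open>v\<close> at its vertex, by
      \<open>bent_cone_less\<close>; the case assumption makes it at least \<open>3 * (1 + B + C)\<close>.\<close>
    define s where "s = v y / (2 * \<rho>) - 3"
    have "k / 2 < v y / (2 * \<rho>)" using False \<rho>(1) by (simp add: field_simps)
    then have s: "s \<ge> 3 * (1 + B + C)" by (simp add: s_def k_def)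
    moreover have "3 * (1 + B + C) \<ge> 1" using pos by simp
    ultimately have s1: "s \<ge> 1" by (rule order_trans[rotated])
    define G where "G = bent_cone s \<epsilon>"
    have G0: "G 0 = 0" using bent_cone_0[OF pos(1)] by (simp add: G_def)
    have Gs: "strict_mono G" unfolding G_def by (rule strict_mono_bent_cone[OF pos(1) s1])
    have Gm: "mono G" using Gs by (rule strict_mono_mono)
    have "G (2 * \<rho>) < (s + 3) * (2 * \<rho>)" unfolding G_def using bent_cone_less pos \<rho> by simp
    also have "\<dots> = v y" using \<rho>(1) by (simp add: s_def)
    finally have vertex: "G (2 * \<rho>) < v y" .
    have contG: "continuous_on UNIV G"
      unfolding G_def
      using DERIV_isCont[OF bent_cone_deriv[OF pos(1)]] by (simp add: continuous_at_imp_continuous_on)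
    have cv: "continuous_on (cball y (3 * \<rho>)) v"
      using sup \<rho>(3) unfolding viscosity_supersolution_def by (auto intro: continuous_on_subset)
    have "G (2 * \<rho> - norm (x0 - y)) \<le> v x0"
    proof (rule ccontr)
      assume "\<not> G (2 * \<rho> - norm (x0 - y)) \<le> v x0"
      then have lt: "v x0 < G (2 * \<rho> - norm (x0 - y))" by simp
      have "0 \<le> 2 * \<rho>" using \<rho>(1) by simp
      from first_contact[OF compact_cball cv v contG Gs G0 this x0K lt]
      obtain z R where z: "z \<in> cball y (3 * \<rho>)" "norm (z - y) \<le> R" "R \<le> 2 * \<rho>"
        "v z = G (R - norm (z - y))"
        "\<And>x. x \<in> cball y (3 * \<rho>) \<Longrightarrow> G (R - norm (x - y)) \<le> v x" by blast
      have "z \<noteq> y"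
      proof
        assume "z = y"
        then have "v y = G R" using z(4) by simp
        also have "\<dots> \<le> G (2 * \<rho>)" by (rule monoD[OF Gm z(3)])
        finally show False using vertex by simp
      qed
      have "z \<in> ball y (3 * \<rho>)" using z(2,3) \<rho>(1) by (simp add: dist_norm norm_minus_commute)
      then have "\<forall>\<^sub>F x in nhds z. x \<in> ball y (3 * \<rho>)" by (intro eventually_nhds_in_open) auto
      then have near: "\<forall>\<^sub>F x in nhds z. G (R - norm (x - y)) \<le> v x"
        by eventually_elim (use z(5) in auto)
      have "z \<in> \<Omega>" using z(1) \<rho>(3) by blast
      define \<tau> where "\<tau> = R - norm (z - y)"
      have \<tau>: "\<tau> \<ge> 0" using z(2) by (simp add: \<tau>_def)
      have "(bent_cone' s \<epsilon> \<tau>)\<^sup>2 * bent_cone'' \<epsilon> \<tau> \<le> \<zeta> z (v z)"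
        unfolding \<tau>_def
        using supersolution_touched_by_radial[OF \<open>open \<Omega>\<close> \<open>z \<in> \<Omega>\<close> \<open>z \<noteq> y\<close> sup
            bent_cone_deriv[OF pos(1)] bent_cone'_deriv[OF pos(1)] isCont_bent_cone''[OF pos(1)]
            Gm[unfolded G_def] z(4)[unfolded G_def] near[unfolded G_def]] .
      also have "\<dots> \<le> B / \<epsilon> * indicat_real {0<..<\<epsilon>} (v z) + C"
        by (rule \<zeta>[OF \<open>z \<in> \<Omega>\<close> v[OF z(1)]])
      also have "v z = bent_cone s \<epsilon> \<tau>" using z(4) by (simp add: G_def \<tau>_def)
      finally show False using bent_cone_strict_subsolution[OF pos s \<tau>] by simp
    qed
    moreover have "s * \<rho> \<le> G \<rho>" unfolding G_def using bent_cone_ge pos \<rho> by simp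
    moreover have "G \<rho> \<le> G (2 * \<rho> - norm (x0 - y))" using x0 by (intro monoD[OF Gm]) simp
    ultimately have "s * \<rho> \<le> v x0" by simp
    moreover have "s * \<rho> = v y / 2 - 3 * \<rho>" using \<rho>(1) by (simp add: s_def field_simps)
    ultimately have "v y \<le> 2 * v x0 + 6 * \<rho>" by simp
    also have "\<dots> \<le> k * v x0 + k * \<rho>"
      using k v0 \<rho>(1) by (intro add_mono mult_right_mono) auto
    finally show ?thesis by (simp add: k_def distrib_left add.commute)
  qed
qed

section \<open>Nondegeneracy and growth of the Perron solution\<close>

text \<open>The barrier starts at height \<open>a * \<epsilon>\<close>, rises by \<open>L = (b - a) * \<epsilon>\<close> over a distance of order
  \<open>\<mu> = m * \<epsilon>\<close>, and is linear with a slope of order \<open>(b - a) / m\<close> from there on. Its infinity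
  Laplacian is at most \<open>48 * L^3 / \<mu>^4\<close>, and \<open>m\<close> is chosen so that this is below \<open>R / \<epsilon>\<close>. Hence it
  is a supersolution, and it also stays above \<open>ul\<close>, so cutting a competitor down to it produces
  a competitor again.\<close>

lemma perron_nondegeneracy:
  fixes \<Omega> :: "(real^'n) set" and u :: "real^'n \<Rightarrow> real"
  assumes "open \<Omega>"
    and pos: "0 \<le> a" "a < b" "\<epsilon> > 0" "R > 0"
    and \<zeta>0: "\<And>x t. x \<in> \<Omega> \<Longrightarrow> t \<ge> 0 \<Longrightarrow> 0 \<le> \<zeta> x t"
    and \<zeta>R: "\<And>x t. x \<in> \<Omega> \<Longrightarrow> a * \<epsilon> \<le> t \<Longrightarrow> t \<le> b * \<epsilon> \<Longrightarrow> R / \<epsilon> \<le> \<zeta> x t"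
    and ul: "viscosity_subsolution \<Omega> (\<lambda>_ _. M) ul" "R / \<epsilon> \<le> M"
    and u: "\<And>x. x \<in> closure \<Omega> \<Longrightarrow>
      ereal (u x) = (INF w\<in>perron_class \<Omega> \<zeta> \<phi> ul uu. ereal (w x))"
    and d: "d > 0" "\<epsilon> \<le> 2 * d" "cball x0 d \<subseteq> \<Omega>"
    and x0: "u x0 > a * \<epsilon>"
    and m: "m = 1 + 48 * (b - a)^3 / R"
  shows "\<exists>x\<in>sphere x0 d. (b - a) / (m * (4 * m + 1)) * d \<le> u x"
proof (rule ccontr)
  define \<kappa> where "\<kappa> = (b - a) / (m * (4 * m + 1))"
  assume "\<not> ?thesis"
  then have small: "u x < \<kappa> * d" if "x \<in> sphere x0 d" for x
    using that by (auto simp: \<kappa>_def not_le)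
  let ?P = "perron_class \<Omega> \<zeta> \<phi> ul uu"
  have x0\<Omega>: "x0 \<in> \<Omega>" using d(1,3) by auto
  then have "\<Omega> \<noteq> {}" by blast
  have "sphere x0 d \<subseteq> \<Omega>" using d(3) by auto
  obtain w0 where w0: "w0 \<in> ?P" "\<And>x. x \<in> sphere x0 d \<Longrightarrow> w0 x < \<kappa> * d"
    using perron_class_uniformly_below[OF u \<open>open \<Omega>\<close> \<open>\<Omega> \<noteq> {}\<close> compact_sphere
        \<open>sphere x0 d \<subseteq> \<Omega>\<close> small] by blast
  have w0': "continuous_on (closure \<Omega>) w0" "\<And>x. x \<in> closure \<Omega> \<Longrightarrow> 0 \<le> w0 x"
    "viscosity_supersolution \<Omega> \<zeta> w0" "\<And>x. x \<in> closure \<Omega> \<Longrightarrow> ul x \<le> w0 x"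
    "\<And>x. x \<in> closure \<Omega> \<Longrightarrow> w0 x \<le> uu x" "\<And>x. x \<in> frontier \<Omega> \<Longrightarrow> w0 x = \<phi> x"
    using w0(1) by (auto simp: perron_class_def)
  define L where "L = (b - a) * \<epsilon>"
  define \<mu> where "\<mu> = m * \<epsilon>"
  have q: "48 * (b - a)^3 / R \<ge> 0" using pos by (intro divide_nonneg_pos mult_nonneg_nonneg) auto
  then have m1: "m \<ge> 1" by (simp add: m)
  have L: "L > 0" and \<mu>: "\<mu> > 0" using pos m1 by (auto simp: L_def \<mu>_def)
  define \<Theta> where "\<Theta> = dish (a * \<epsilon>) L \<mu> x0"
  have C2: "Ck_on 2 \<Omega> \<Theta>" unfolding \<Theta>_def by (rule Ck_on_2_dish[OF \<mu>])
  have "Ck_on 2 UNIV \<Theta>" unfolding \<Theta>_def by (rule Ck_on_2_dish[OF \<mu>])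
  then have contU: "continuous_on UNIV \<Theta>" by (rule Ck_on_2_imp_continuous_on)
  have cont\<Theta>: "continuous_on X \<Theta>" for X by (rule continuous_on_subset[OF contU]) simp
  have \<Theta>ge: "a * \<epsilon> \<le> \<Theta> x" for x unfolding \<Theta>_def using L by (intro dish_ge) simp
  moreover have "0 \<le> a * \<epsilon>" using pos by simp
  ultimately have \<Theta>0: "0 \<le> \<Theta> x" for x using order_trans by blast
  have lapR: "infinity_laplacian \<Theta> x < R / \<epsilon>" for x
  proof -
    have "infinity_laplacian \<Theta> x \<le> 48 * L^3 / \<mu>^4"
      unfolding \<Theta>_def by (rule infinity_laplacian_dish_le(1)[OF \<mu> L])
    also have "\<dots> = (48 * (b - a)^3 / m^4) / \<epsilon>"
      using pos m1 by (simp add: L_def \<mu>_def power_mult_distrib field_simps eval_nat_numeral)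
    also have "\<dots> < R / \<epsilon>"
    proof (rule divide_strict_right_mono)
      have "48 * (b - a)^3 / R < m" by (simp add: m)
      also have "m \<le> m^4" using m1 by (rule self_le_power) simp
      finally show "48 * (b - a)^3 / m^4 < R" using pos m1 by (simp add: field_simps)
    qed fact
    finally show ?thesis .
  qed
  have sup\<Theta>: "viscosity_supersolution \<Omega> \<zeta> \<Theta>"
  proof (rule viscosity_supersolution_classical[OF \<open>open \<Omega>\<close> C2])
    fix x assume x: "x \<in> \<Omega>"
    show "infinity_laplacian \<Theta> x \<le> \<zeta> x (\<Theta> x)"
    proof (cases "infinity_laplacian \<Theta> x \<le> 0")
      case True
      also have "0 \<le> \<zeta> x (\<Theta> x)" by (rule \<zeta>0[OF x \<Theta>0])
      finally show ?thesis .
    next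
      case False
      then have "\<Theta> x \<le> a * \<epsilon> + L"
        using infinity_laplacian_dish_le(2)[OF \<mu> L] unfolding \<Theta>_def by blast
      then have "\<Theta> x \<le> b * \<epsilon>" by (simp add: L_def left_diff_distrib)
      then have "R / \<epsilon> \<le> \<zeta> x (\<Theta> x)" by (rule \<zeta>R[OF x \<Theta>ge])
      with lapR[of x] show ?thesis by simp
    qed
  qed
  have rim: "\<kappa> * d \<le> \<Theta> x" if "x \<in> sphere x0 d" for x
  proof -
    have n: "norm (x - x0) = d" using that by (simp add: dist_norm norm_minus_commute)
    \<comment> \<open>As \<open>d \<ge> \<epsilon> / 2\<close>, the sphere lies at distance at least \<open>t * \<mu>\<close> from the centre.\<close>
    define t where "t = 1 / (2 * m)"
    have "norm (x - x0) \<ge> t * \<mu>" using d(2) m1 by (simp add: n t_def \<mu>_def)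
    from dish_growth[OF \<mu> _ _ this, of L "a * \<epsilon>"]
    have "a * \<epsilon> + L * (t / (2 + t) * (d / \<mu>)) \<le> \<Theta> x" using L m1 by (simp add: \<Theta>_def n t_def)
    moreover have "L * (t / (2 + t) * (d / \<mu>)) = \<kappa> * d"
    proof -
      have "t / (2 + t) = 1 / (4 * m + 1)" using m1 by (simp add: t_def field_simps)
      moreover have "L * (1 / (4 * m + 1) * (d / \<mu>)) = \<kappa> * d"
      proof -
        have "L * (1 / (4 * m + 1) * (d / \<mu>)) = ((b - a) * d * \<epsilon>) / ((m * (4 * m + 1)) * \<epsilon>)"
          by (simp only: L_def \<mu>_def times_divide_eq_right times_divide_eq_left divide_divide_eq_left
              mult_1_left mult_1_right mult_ac)
        also have "\<dots> = ((b - a) * d) / (m * (4 * m + 1))"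
          using pos by (intro mult_divide_mult_cancel_right) simp
        finally show ?thesis by (simp add: \<kappa>_def)
      qed
      ultimately show ?thesis by simp
    qed
    ultimately show ?thesis using \<open>0 \<le> a * \<epsilon>\<close> by linarith
  qed
  have ul\<Theta>: "ul x \<le> \<Theta> x" if "x \<in> cball x0 d" for x
  proof (rule subsolution_le_strict_supersolution[OF \<open>open \<Omega>\<close> ul(1) compact_cball d(3) C2 _ _ that])
    show "infinity_laplacian \<Theta> x < M" for x using lapR[of x] ul(2) by simp
    fix y assume "y \<in> frontier (cball x0 d)"
    then have y: "y \<in> sphere x0 d" by (simp add: frontier_cball)
    then have "y \<in> closure \<Omega>" using \<open>sphere x0 d \<subseteq> \<Omega>\<close> closure_subset by blast
    from w0'(4)[OF this] w0(2)[OF y] rim[OF y] show "ul y \<le> \<Theta> y" by linarith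
  qed
  define w where "w x = (if x \<in> cball x0 d then min (w0 x) (\<Theta> x) else w0 x)" for x
  have w_le: "w x \<le> w0 x" for x by (simp add: w_def)
  have w_rim: "w x = w0 x" if "x \<notin> ball x0 d" for x
  proof (cases "x \<in> cball x0 d")
    case True
    then have "x \<in> sphere x0 d" using that by auto
    from w0(2)[OF this] rim[OF this] show ?thesis by (simp add: w_def)
  qed (simp add: w_def)
  have "w \<in> ?P"
    unfolding perron_class_def mem_Collect_eq
  proof (intro conjI ballI)
    have cb: "cball x0 d \<subseteq> closure \<Omega>" using d(3) closure_subset by blast
    have "continuous_on (cball x0 d \<union> (closure \<Omega> - ball x0 d)) w"
      unfolding w_def
    proof (rule continuous_on_cases)
      show "closed (closure \<Omega> - ball x0 d)" by (intro closed_Diff) auto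
      show "continuous_on (cball x0 d) (\<lambda>x. min (w0 x) (\<Theta> x))"
        by (intro continuous_on_min cont\<Theta> continuous_on_subset[OF w0'(1) cb])
      show "continuous_on (closure \<Omega> - ball x0 d) w0"
        by (rule continuous_on_subset[OF w0'(1)]) blast
      show "\<forall>x. x \<in> cball x0 d \<and> x \<notin> cball x0 d \<or> x \<in> closure \<Omega> - ball x0 d \<and> x \<in> cball x0 d
          \<longrightarrow> min (w0 x) (\<Theta> x) = w0 x"
      proof (intro allI impI)
        fix x
        assume "x \<in> cball x0 d \<and> x \<notin> cball x0 d \<or> x \<in> closure \<Omega> - ball x0 d \<and> x \<in> cball x0 d"
        then have x: "x \<notin> ball x0 d" "x \<in> cball x0 d" by blast+
        show "min (w0 x) (\<Theta> x) = w0 x"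
          using w_rim[OF x(1)] x(2) by (simp only: w_def if_True)
      qed
    qed simp
    moreover have "cball x0 d \<union> (closure \<Omega> - ball x0 d) = closure \<Omega>"
      using cb ball_subset_cball[of x0 d] by blast
    ultimately show contw: "continuous_on (closure \<Omega>) w" by simp
    show "viscosity_supersolution \<Omega> \<zeta> w"
    proof (rule viscosity_supersolution_touched_from_above)
      show "continuous_on \<Omega> w" by (rule continuous_on_subset[OF contw closure_subset])
      fix x assume "x \<in> \<Omega>"
      show "\<exists>v. viscosity_supersolution \<Omega> \<zeta> v \<and> v x = w x \<and> (\<forall>\<^sub>F y in nhds x. w y \<le> v y)"
      proof (cases "x \<in> ball x0 d")
        case True
        then have "\<forall>\<^sub>F y in nhds x. y \<in> ball x0 d" by (intro eventually_nhds_in_open) auto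
        then have "\<forall>\<^sub>F y in nhds x. w y \<le> min (w0 y) (\<Theta> y)"
          by eventually_elim (simp add: w_def)
        moreover have "min (w0 x) (\<Theta> x) = w x" using True by (simp add: w_def)
        ultimately show ?thesis
          using viscosity_supersolution_min[OF w0'(3) sup\<Theta>]
          by (intro exI[of _ "\<lambda>x. min (w0 x) (\<Theta> x)"] conjI)
      next
        case False
        then show ?thesis using w0'(3) w_le w_rim[OF False] by (intro exI[of _ w0] conjI) simp_all
      qed
    qed
    show "0 \<le> w x" if "x \<in> closure \<Omega>" for x using w0'(2)[OF that] \<Theta>0 by (simp add: w_def)
    show "ul x \<le> w x" if "x \<in> closure \<Omega>" for x using w0'(4)[OF that] ul\<Theta> by (simp add: w_def)
    show "w x \<le> uu x" if "x \<in> closure \<Omega>" for x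
      using w_le w0'(5)[OF that] by (rule order_trans)
    show "w x = \<phi> x" if "x \<in> frontier \<Omega>" for x
    proof -
      have "x \<notin> \<Omega>" using that \<open>open \<Omega>\<close> by (simp add: frontier_def interior_open)
      then have "x \<notin> ball x0 d" using d(3) ball_subset_cball[of x0 d] by blast
      then show ?thesis using w_rim w0'(6)[OF that] by simp
    qed
  qed
  have "ereal (u x0) = (INF w\<in>?P. ereal (w x0))" using u x0\<Omega> closure_subset by blast
  also have "\<dots> \<le> ereal (w x0)" using \<open>w \<in> ?P\<close> by (rule INF_lower)
  finally have "u x0 \<le> w x0" by simp
  also have "\<dots> \<le> \<Theta> x0" using d(1) by (simp add: w_def)
  also have "\<Theta> x0 = a * \<epsilon>" by (simp add: \<Theta>_def dish_center)
  finally show False using x0 by simp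
qed

text \<open>The estimate for a single competitor is affine and increasing in its value at \<open>x0\<close>, so it
  survives the infimum.\<close>

lemma perron_linear_growth:
  fixes \<Omega> :: "(real^'n) set" and u :: "real^'n \<Rightarrow> real"
  assumes "open \<Omega>"
    and u: "\<And>x. x \<in> closure \<Omega> \<Longrightarrow>
      ereal (u x) = (INF w\<in>perron_class \<Omega> \<zeta> \<phi> ul uu. ereal (w x))"
    and \<zeta>: "\<And>x t. x \<in> \<Omega> \<Longrightarrow> t \<ge> 0 \<Longrightarrow> \<zeta> x t \<le> B / \<epsilon> * indicat_real {0<..<\<epsilon>} t + C"
    and pos: "\<epsilon> > 0" "B \<ge> 0" "C \<ge> 0"
    and \<rho>: "0 < \<rho>" "\<rho> \<le> 1 / 2" "cball x0 (4 * \<rho>) \<subseteq> \<Omega>"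
    and y: "y \<in> ball x0 \<rho>"
  shows "u y \<le> (12 + 6 * B + 6 * C) * (\<rho> + u x0)"
proof -
  define k where "k = 12 + 6 * B + 6 * C"
  have k: "k > 0" using pos by (simp add: k_def)
  let ?P = "perron_class \<Omega> \<zeta> \<phi> ul uu"
  have sub: "cball y (3 * \<rho>) \<subseteq> cball x0 (4 * \<rho>)"
    using y by (intro cball_subset_cball_iff[THEN iffD2]) (simp add: dist_commute)
  have mem: "x0 \<in> closure \<Omega>" "y \<in> closure \<Omega>" using \<rho> y closure_subset[of \<Omega>] by (auto simp: subset_eq)
  have "ereal (u y / k - \<rho>) \<le> (INF w\<in>?P. ereal (w x0))"
  proof (rule INF_greatest)
    fix w assume w: "w \<in> ?P"
    have "ereal (u y) \<le> ereal (w y)" unfolding u[OF mem(2)] using w by (rule INF_lower)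
    also have "w y \<le> k * (\<rho> + w x0)"
      unfolding k_def
    proof (rule supersolution_linear_growth[OF \<open>open \<Omega>\<close> _ \<zeta> pos \<rho>(1,2)])
      show "viscosity_supersolution \<Omega> \<zeta> w" using w by (simp add: perron_class_def)
      show "cball y (3 * \<rho>) \<subseteq> \<Omega>" using sub \<rho>(3) by blast
      then have "cball y (3 * \<rho>) \<subseteq> closure \<Omega>" using closure_subset by (rule order_trans)
      then show "0 \<le> w x" if "x \<in> cball y (3 * \<rho>)" for x
        using w subsetD[OF _ that] by (simp add: perron_class_def)
      show "norm (x0 - y) \<le> \<rho>" using y by (simp add: dist_norm)
    qed
    finally have "u y \<le> k * (\<rho> + w x0)" by simp
    then show "ereal (u y / k - \<rho>) \<le> ereal (w x0)" using k by (simp add: field_simps)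
  qed
  also have "\<dots> = ereal (u x0)" using u[OF mem(1)] ..
  finally have "u y \<le> k * (\<rho> + u x0)" using k by (simp add: field_simps)
  then show ?thesis by (simp only: k_def)
qed

lemma admissible_nonlinearity_lower_bound:
  assumes adm: "admissible_nonlinearity \<Omega> B C a b R \<epsilon> \<zeta>" and "0 \<le> a" "\<epsilon> > 0"
    and x: "x \<in> \<Omega>" and t: "a * \<epsilon> \<le> t" "t \<le> b * \<epsilon>"
  shows "R / \<epsilon> \<le> \<zeta> x t"
proof -
  let ?f = "\<lambda>(x, t). \<epsilon> * \<zeta> x (\<epsilon> * t)"
  have "bdd_below (?f ` (\<Omega> \<times> {a..b}))"
  proof (rule bdd_belowI2)
    fix p assume "p \<in> \<Omega> \<times> {a..b}"
    then obtain y s where p: "p = (y, s)" "y \<in> \<Omega>" "a \<le> s" by auto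
    then have "0 \<le> \<epsilon> * s" using assms(2,3) by simp
    then have "0 \<le> \<zeta> y (\<epsilon> * s)" using adm p(2) by (simp add: admissible_nonlinearity_def)
    then show "0 \<le> ?f p" using assms(3) p(1) by simp
  qed
  moreover have "(x, t / \<epsilon>) \<in> \<Omega> \<times> {a..b}" using x t assms(3) by (simp add: field_simps)
  ultimately have "(INF p\<in>\<Omega> \<times> {a..b}. ?f p) \<le> ?f (x, t / \<epsilon>)" by (rule cINF_lower)
  moreover have "(INF p\<in>\<Omega> \<times> {a..b}. ?f p) = R" using adm by (simp add: admissible_nonlinearity_def)
  ultimately have "R \<le> \<epsilon> * \<zeta> x t" using assms(3) by simp
  then show ?thesis using assms(3) by (simp add: field_simps)
qed

text \<open>For \<open>a \<ge> 1\<close> the value \<open>a * \<epsilon>\<close> is outside the singular layer, where \<open>\<zeta>\<close> is at most \<open>C\<close>; the lower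
  bound \<open>R / \<epsilon>\<close> then fails for small \<open>\<epsilon>\<close>. It follows that \<open>a * \<epsilon> < \<epsilon>\<close>, so points with \<open>u > \<epsilon>\<close> lie
  above the bottom of the barrier.\<close>

lemma admissible_nonlinearity_lower_level_less_1:
  assumes adm: "\<And>\<epsilon>. \<epsilon> > 0 \<Longrightarrow> admissible_nonlinearity \<Omega> B C a b R \<epsilon> (\<zeta> \<epsilon>)"
    and "\<Omega> \<noteq> {}" "a \<le> b" "R > 0" "C \<ge> 0"
  shows "a < 1"
proof (rule ccontr)
  assume "\<not> a < 1"
  obtain x where x: "x \<in> \<Omega>" using \<open>\<Omega> \<noteq> {}\<close> by blast
  define \<epsilon> where "\<epsilon> = R / (C + 1)"
  have \<epsilon>: "\<epsilon> > 0" using assms by (simp add: \<epsilon>_def)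
  have "R / \<epsilon> \<le> \<zeta> \<epsilon> x (a * \<epsilon>)"
    using \<epsilon> assms(3) \<open>\<not> a < 1\<close>
    by (intro admissible_nonlinearity_lower_bound[OF adm[OF \<epsilon>] _ _ x]) (auto intro: mult_right_mono)
  also have "\<dots> \<le> B / \<epsilon> * indicat_real {0<..<\<epsilon>} (a * \<epsilon>) + C"
  proof -
    have "0 \<le> a * \<epsilon>" using \<epsilon> \<open>\<not> a < 1\<close> by simp
    then show ?thesis using adm[OF \<epsilon>] x unfolding admissible_nonlinearity_def by blast
  qed
  also have "\<dots> = C" using \<epsilon> \<open>\<not> a < 1\<close> by (simp add: indicator_def)
  also have "R / \<epsilon> = C + 1" using assms by (simp add: \<epsilon>_def)
  finally show False by simp
qed

theorem theorem4p2:
  fixes A B C a b R :: real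
  assumes "A > 0" and "B \<ge> 0" and "C \<ge> 0" and "0 \<le> a" and "a < b" and "R > 0"
  shows "\<exists>c>0. \<forall>(\<Omega> :: (real^'n) set) \<Omega>' (\<phi> :: real \<Rightarrow> real^'n \<Rightarrow> real)
            (\<zeta> :: real \<Rightarrow> real^'n \<Rightarrow> real \<Rightarrow> real) (u :: real \<Rightarrow> real^'n \<Rightarrow> real).
      smooth_bounded_domain \<Omega> \<longrightarrow>
      compact (closure \<Omega>') \<longrightarrow> closure \<Omega>' \<subseteq> \<Omega> \<longrightarrow>
      (\<forall>\<epsilon>>0. admissible_boundary_datum \<Omega> A (\<phi> \<epsilon>)) \<longrightarrow>
      (\<forall>\<epsilon>>0. admissible_nonlinearity \<Omega> B C a b R \<epsilon> (\<zeta> \<epsilon>)) \<longrightarrow>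
      (\<forall>\<epsilon>>0. perron_solution \<Omega> (\<zeta> \<epsilon>) (\<phi> \<epsilon>) (u \<epsilon>)) \<longrightarrow>
      (\<exists>\<rho>0>0. \<forall>\<epsilon>>0. \<forall>x0\<in>{x\<in>\<Omega>. u \<epsilon> x > \<epsilon>} \<inter> \<Omega>'. \<forall>\<rho>. \<epsilon> \<le> \<rho> \<and> \<rho> \<le> \<rho>0 \<longrightarrow>
         c * \<rho> < (SUP x\<in>ball x0 \<rho>. u \<epsilon> x) \<and>
         (SUP x\<in>ball x0 \<rho>. u \<epsilon> x) \<le> inverse c * (\<rho> + u \<epsilon> x0))"
proof -
  define m where "m = 1 + 48 * (b - a)^3 / R"
  define \<kappa> where "\<kappa> = (b - a) / (m * (4 * m + 1))"
  define k where "k = 12 + 6 * B + 6 * C"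
  \<comment> \<open>Nondegeneracy is applied on the sphere of radius \<open>\<rho> / 2\<close>, which lies in the open ball of
    radius \<open>\<rho>\<close>; the remaining factor \<open>1 / 2\<close> in \<open>\<kappa> / 4\<close> makes the inequality strict.\<close>
  define c where "c = min (\<kappa> / 4) (1 / k)"
  have "48 * (b - a)^3 / R \<ge> 0" using assms by (intro divide_nonneg_pos mult_nonneg_nonneg) auto
  then have "m > 0" by (simp add: m_def)
  then have \<kappa>: "\<kappa> > 0" using assms by (simp add: \<kappa>_def)
  have k: "k > 0" using assms by (simp add: k_def)
  have c: "c > 0" "c \<le> \<kappa> / 4" "c \<le> 1 / k" using \<kappa> k by (auto simp: c_def)
  have kc: "k \<le> inverse c" using c(1,3) k by (simp add: field_simps)
  show ?thesis
  proof (rule exI[of _ c], rule conjI[OF c(1)], intro allI impI)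
    fix \<Omega> :: "(real^'n) set" and \<Omega>' \<phi> \<zeta> u
    assume \<Omega>: "smooth_bounded_domain \<Omega>" and \<Omega>': "compact (closure \<Omega>')" "closure \<Omega>' \<subseteq> \<Omega>"
      and "\<forall>\<epsilon>>0. admissible_boundary_datum \<Omega> A (\<phi> \<epsilon>)"
      and "\<forall>\<epsilon>>0. admissible_nonlinearity \<Omega> B C a b R \<epsilon> (\<zeta> \<epsilon>)"
      and "\<forall>\<epsilon>>0. perron_solution \<Omega> (\<zeta> \<epsilon>) (\<phi> \<epsilon>) (u \<epsilon>)"
    then have adm: "admissible_nonlinearity \<Omega> B C a b R \<epsilon> (\<zeta> \<epsilon>)"
      and per: "perron_solution \<Omega> (\<zeta> \<epsilon>) (\<phi> \<epsilon>) (u \<epsilon>)" if "\<epsilon> > 0" for \<epsilon>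
      using that by simp_all
    have op: "open \<Omega>" "\<Omega> \<noteq> {}" using \<Omega> by (auto simp: smooth_bounded_domain_def)
    have a1: "a < 1"
      using admissible_nonlinearity_lower_level_less_1[OF adm op(2)] assms by simp
    obtain \<delta> where \<delta>: "\<delta> > 0" "(\<Union>x\<in>closure \<Omega>'. cball x \<delta>) \<subseteq> \<Omega>"
      using compact_subset_open_imp_cball_epsilon_subset[OF \<Omega>'(1) op(1) \<Omega>'(2)] .
    show "\<exists>\<rho>0>0. \<forall>\<epsilon>>0. \<forall>x0\<in>{x\<in>\<Omega>. u \<epsilon> x > \<epsilon>} \<inter> \<Omega>'. \<forall>\<rho>. \<epsilon> \<le> \<rho> \<and> \<rho> \<le> \<rho>0 \<longrightarrow>
         c * \<rho> < (SUP x\<in>ball x0 \<rho>. u \<epsilon> x) \<and>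
         (SUP x\<in>ball x0 \<rho>. u \<epsilon> x) \<le> inverse c * (\<rho> + u \<epsilon> x0)"
    \<comment> \<open>The cone around a point of the ball of radius \<open>\<rho>\<close> needs a further distance \<open>3 * \<rho>\<close>, and the
      exponential in its profile is estimated on the interval up to \<open>2 * \<rho> \<le> 1\<close>.\<close>
    proof (rule exI[of _ "min (\<delta> / 4) (1 / 2)"], rule conjI, goal_cases)
      case 1
      show ?case using \<delta>(1) by simp
    next
      case 2
      show ?case
      proof (intro allI impI ballI)
        fix \<epsilon> x0 \<rho>
        assume "0 < \<epsilon>" and x0: "x0 \<in> {x \<in> \<Omega>. \<epsilon> < u \<epsilon> x} \<inter> \<Omega>'"
          and \<rho>\<epsilon>: "\<epsilon> \<le> \<rho> \<and> \<rho> \<le> min (\<delta> / 4) (1 / 2)"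
        then have \<rho>: "0 < \<rho>" "\<epsilon> \<le> \<rho>" "\<rho> \<le> 1 / 2" "4 * \<rho> \<le> \<delta>" by auto
        note adm = adm[OF \<open>0 < \<epsilon>\<close>]
        have \<zeta>: "0 \<le> \<zeta> \<epsilon> x t" "\<zeta> \<epsilon> x t \<le> B / \<epsilon> * indicat_real {0<..<\<epsilon>} t + C"
          if "x \<in> \<Omega>" "t \<ge> 0" for x t
          using adm that by (auto simp: admissible_nonlinearity_def)
        note \<zeta>R = admissible_nonlinearity_lower_bound[OF adm \<open>0 \<le> a\<close> \<open>0 < \<epsilon>\<close>]
        have "x0 \<in> closure \<Omega>'" using x0 closure_subset[of \<Omega>'] by blast
        then have "cball x0 \<delta> \<subseteq> \<Omega>" using \<delta>(2) by blast
        then have ball4: "cball x0 (4 * \<rho>) \<subseteq> \<Omega>" using \<rho>(4) subset_cball by blast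
        define M where "M = (SUP (x, t)\<in>\<Omega> \<times> {0..}. \<zeta> \<epsilon> x t)"
        obtain ul uu where ul: "dirichlet_solution \<Omega> (\<lambda>_ _. M) (\<phi> \<epsilon>) ul"
          and u: "\<And>x. x \<in> closure \<Omega> \<Longrightarrow>
            ereal (u \<epsilon> x) = (INF w\<in>perron_class \<Omega> (\<zeta> \<epsilon>) (\<phi> \<epsilon>) ul uu. ereal (w x))"
          using per[OF \<open>0 < \<epsilon>\<close>] unfolding perron_solution_def M_def by blast
        have sub: "viscosity_subsolution \<Omega> (\<lambda>_ _. M) ul"
          using ul by (simp add: dirichlet_solution_def viscosity_solution_def)
        have RM: "R / \<epsilon> \<le> M"
        proof -
          have x: "x0 \<in> \<Omega>" using x0 by blast
          have "R / \<epsilon> \<le> \<zeta> \<epsilon> x0 (a * \<epsilon>)" using assms \<open>0 < \<epsilon>\<close> by (intro \<zeta>R[OF x]) auto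
          also have "\<dots> = (\<lambda>(x, t). \<zeta> \<epsilon> x t) (x0, a * \<epsilon>)" by simp
          also have "\<dots> \<le> M"
            unfolding M_def
          proof (rule cSUP_upper)
            show "(x0, a * \<epsilon>) \<in> \<Omega> \<times> {0..}" using x assms(4) \<open>0 < \<epsilon>\<close> by simp
            show "bdd_above ((\<lambda>(x, t). \<zeta> \<epsilon> x t) ` (\<Omega> \<times> {0..}))"
            proof (rule bdd_aboveI2)
              fix p assume "p \<in> \<Omega> \<times> {0::real..}"
              then obtain x t where p: "p = (x, t)" "x \<in> \<Omega>" "t \<ge> 0" by auto
              have "B / \<epsilon> * indicat_real {0<..<\<epsilon>} t \<le> B / \<epsilon> * 1"
                using assms(2) \<open>0 < \<epsilon>\<close> by (intro mult_left_mono) (auto simp: indicator_def)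
              with \<zeta>(2)[OF p(2,3)] show "(\<lambda>(x, t). \<zeta> \<epsilon> x t) p \<le> B / \<epsilon> + C" by (simp add: p(1))
            qed
          qed
          finally show ?thesis .
        qed
        have up: "u \<epsilon> y \<le> k * (\<rho> + u \<epsilon> x0)" if "y \<in> ball x0 \<rho>" for y
          unfolding k_def
          by (rule perron_linear_growth[OF op(1) u \<zeta>(2) \<open>0 < \<epsilon>\<close> assms(2,3) \<rho>(1,3) ball4 that])
        have "a * \<epsilon> \<le> 1 * \<epsilon>" using a1 \<open>0 < \<epsilon>\<close> by (intro mult_right_mono) auto
        then have "u \<epsilon> x0 > a * \<epsilon>" using x0 by simp
        moreover have "cball x0 (\<rho> / 2) \<subseteq> \<Omega>"
          using ball4 subset_cball[of "\<rho> / 2" "4 * \<rho>" x0] \<rho>(1) by auto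
        ultimately have "\<exists>x\<in>sphere x0 (\<rho> / 2). (b - a) / (m * (4 * m + 1)) * (\<rho> / 2) \<le> u \<epsilon> x"
          using \<rho> \<open>0 < \<epsilon>\<close>
          by (intro perron_nondegeneracy[OF op(1) assms(4,5) _ assms(6) \<zeta>(1) \<zeta>R sub RM u _ _ _ _ m_def])
            auto
        then obtain x where x: "x \<in> sphere x0 (\<rho> / 2)" "\<kappa> * (\<rho> / 2) \<le> u \<epsilon> x"
          by (auto simp: \<kappa>_def)
        show "c * \<rho> < (SUP x\<in>ball x0 \<rho>. u \<epsilon> x) \<and>
           (SUP x\<in>ball x0 \<rho>. u \<epsilon> x) \<le> inverse c * (\<rho> + u \<epsilon> x0)"
        proof
          have "c * \<rho> \<le> \<kappa> / 4 * \<rho>" using c(2) \<rho>(1) by (intro mult_right_mono) auto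
          also have "\<dots> < \<kappa> * (\<rho> / 2)" using \<kappa> \<rho>(1) by simp
          also have "\<dots> \<le> u \<epsilon> x" by fact
          also have "\<dots> \<le> (SUP x\<in>ball x0 \<rho>. u \<epsilon> x)"
          proof (rule cSUP_upper)
            show "x \<in> ball x0 \<rho>" using x(1) \<rho>(1) by simp
            show "bdd_above (u \<epsilon> ` ball x0 \<rho>)" using up by (rule bdd_aboveI2)
          qed
          finally show "c * \<rho> < (SUP x\<in>ball x0 \<rho>. u \<epsilon> x)" .
          have "(SUP x\<in>ball x0 \<rho>. u \<epsilon> x) \<le> k * (\<rho> + u \<epsilon> x0)"
            using \<rho>(1) up by (intro cSUP_least) auto
          also have "\<dots> \<le> inverse c * (\<rho> + u \<epsilon> x0)"
            using kc \<rho>(1) x0 \<open>0 < \<epsilon>\<close> by (intro mult_right_mono) auto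
          finally show "(SUP x\<in>ball x0 \<rho>. u \<epsilon> x) \<le> inverse c * (\<rho> + u \<epsilon> x0)" .
        qed
      qed
    qed
  qed
qed

end
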